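(* Let $n\ge1$ be an integer, $0<\tau\le p<\infty$, $\alpha>0$, and let $\mu$ be a positive Borel measure on $\mathbb R^{n+1}_+$. Then the following conditions are equivalent: $1^o$. The measure $\mu$ satisfies a Carleson type condition: there is a constant $C$ such that $$\mu(\Delta_k)\le C\,\eta_k^{\,n+\alpha p},\qquad k\ge1,$$ where $(\xi_k,\eta_k)$ is the center of $\Delta_k$. $2^o$. The space $F^{p,\tau}_\alpha$ is continuously embedded into $L^p(\mathbb R^{n+1}_+,d\mu)$.
   Context: $\mathbb R^{n+1}_+=\{(x,t):x\in\mathbb R^n,\ t>0\}$; $h(\mathbb R^{n+1}_+)$ is the space of harmonic functions on it. The harmonic Triebel-Lizorkin space $F^{p,q}_\alpha$ ($0<p,q<\infty$) consists of all $f\in h(\mathbb R^{n+1}_+)$ with $$\|f\|_{F^{p,q}_\alpha}^p=\int_{\mathbb R^n}\Big(\int_0^\infty|f(x,t)|^q\,t^{\alpha q-1}\,dt\Big)^{p/q}dx<\infty.$$ $\{\Delta_k\}_{k\ge1}$ is a fixed Whitney decomposition of $\mathbb R^{n+1}_+$: closed cubes in $\mathbb R^{n+1}_+$ with sides parallel to the coordinate axes, with pairwise disjoint interiors, $\bigcup_k\Delta_k=\mathbb R^{n+1}_+$, ${\rm diam}\,\Delta_k\asymp{\rm dist}(\Delta_k,\partial\mathbb R^{n+1}_+)$ uniformly in $k$, and such that the cubes $\Delta_k^\ast$, with the same centers $(\xi_k,\eta_k)$ as $\Delta_k$ but enlarged $5/4$ times, form a finitely overlapping covering of $\mathbb R^{n+1}_+$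 (so $\Delta_k^*\subset\mathbb R^{n+1}_+$ and $\sum_k\chi_{\Delta_k^\ast}\le C_n$), with $t\asymp\eta_k$ for $(x,t)\in\Delta_k^\ast$. *)

theory Defs
  imports "HOL-Analysis.Analysis"
begin

definition upper_halfspace :: "((real^'n) \<times> real) set" where
  "upper_halfspace = {(x, t). t > 0}"

text \<open>\<open>f\<close> is \<open>C\<^sup>2\<close> on \<open>S\<close> with first and second Frechet derivatives \<open>D\<close> and \<open>H\<close>, and the
  trace of the Hessian \<open>H z\<close>, which is the Laplacian of \<open>f\<close> at \<open>z\<close>, vanishes. Meant for open \<open>S\<close>;
  values of \<open>f\<close> outside \<open>S\<close> are irrelevant then.\<close>

definition harmonic_on :: "('a::euclidean_space \<Rightarrow> real) \<Rightarrow> 'a set \<Rightarrow> bool" where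
  "harmonic_on f S \<longleftrightarrow>
     (\<exists>(D :: 'a \<Rightarrow> 'a \<Rightarrow>\<^sub>L real) (H :: 'a \<Rightarrow> 'a \<Rightarrow>\<^sub>L ('a \<Rightarrow>\<^sub>L real)).
        (\<forall>z\<in>S. (f has_derivative blinfun_apply (D z)) (at z)) \<and>
        (\<forall>z\<in>S. (D has_derivative blinfun_apply (H z)) (at z)) \<and>
        continuous_on S H \<and>
        (\<forall>z\<in>S. (\<Sum>b\<in>Basis. blinfun_apply (blinfun_apply (H z) b) b) = 0))"

text \<open>Real powers of extended nonnegative reals; meant for positive exponents only.\<close>

definition enn_powr :: "ennreal \<Rightarrow> real \<Rightarrow> ennreal" where
  "enn_powr a r = (if a = \<infinity> then \<infinity> else ennreal (enn2real a powr r))"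

definition TL_norm :: "real \<Rightarrow> real \<Rightarrow> real \<Rightarrow> ((real^'n) \<times> real \<Rightarrow> real) \<Rightarrow> ennreal" where
  "TL_norm p q \<alpha> f =
     enn_powr (\<integral>\<^sup>+x. enn_powr
                 (\<integral>\<^sup>+t\<in>{0<..}. ennreal (\<bar>f (x, t)\<bar> powr q * t powr (\<alpha> * q - 1)) \<partial>lborel)
                 (p / q) \<partial>lborel)
       (1 / p)"

definition TL_space :: "real \<Rightarrow> real \<Rightarrow> real \<Rightarrow> ((real^'n) \<times> real \<Rightarrow> real) set" where
  "TL_space p q \<alpha> = {f. harmonic_on f upper_halfspace \<and> TL_norm p q \<alpha> f < \<infinity>}"

definition Lp_norm :: "real \<Rightarrow> 'a measure \<Rightarrow> ('a \<Rightarrow> real) \<Rightarrow> ennreal" where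
  "Lp_norm p M f = enn_powr (\<integral>\<^sup>+z. ennreal (\<bar>f z\<bar> powr p) \<partial>M) (1 / p)"

definition Lp_space :: "real \<Rightarrow> 'a measure \<Rightarrow> ('a \<Rightarrow> real) set" where
  "Lp_space p M = {f \<in> borel_measurable M. Lp_norm p M f < \<infinity>}"

text \<open>The inclusion map is well defined and bounded for the (quasi-)norms \<open>N\<close> on \<open>X\<close> and \<open>N'\<close>
  on \<open>Y\<close>.\<close>

definition continuously_embedded ::
    "'f set \<Rightarrow> ('f \<Rightarrow> ennreal) \<Rightarrow> 'f set \<Rightarrow> ('f \<Rightarrow> ennreal) \<Rightarrow> bool" where
  "continuously_embedded X N Y N' \<longleftrightarrow>
     X \<subseteq> Y \<and> (\<exists>C::real. C \<ge> 0 \<and> (\<forall>f\<in>X. N' f \<le> ennreal C * N f))"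

text \<open>Closed axis-parallel cube with centre \<open>c\<close> and side length \<open>s\<close>.\<close>

definition cube :: "'a::euclidean_space \<Rightarrow> real \<Rightarrow> 'a set" where
  "cube c s = cbox (c - (s / 2) *\<^sub>R One) (c + (s / 2) *\<^sub>R One)"

text \<open>The \<open>k\<close>-th cube, for \<open>k \<ge> 1\<close>, has centre \<open>(\<xi> k, \<eta> k)\<close> and side length \<open>s k\<close>; the values
  at \<open>k = 0\<close> play no role.\<close>

definition whitney_decomposition ::
    "(nat \<Rightarrow> real^'n) \<Rightarrow> (nat \<Rightarrow> real) \<Rightarrow> (nat \<Rightarrow> real) \<Rightarrow> bool" where
  "whitney_decomposition \<xi> \<eta> s \<longleftrightarrow>
     (let \<Delta> = (\<lambda>k. cube (\<xi> k, \<eta> k) (s k));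
          \<Delta>' = (\<lambda>k. cube (\<xi> k, \<eta> k) (5 / 4 * s k))
      in (\<forall>k\<ge>1. s k > 0) \<and>
         (\<forall>j\<ge>1. \<forall>k\<ge>1. j \<noteq> k \<longrightarrow> interior (\<Delta> j) \<inter> interior (\<Delta> k) = {}) \<and>
         (\<Union>k\<in>{1..}. \<Delta> k) = upper_halfspace \<and>
         (\<exists>a b. 0 < a \<and> 0 < b \<and>
            (\<forall>k\<ge>1. a * setdist (\<Delta> k) (frontier upper_halfspace) \<le> diameter (\<Delta> k) \<and>
                   diameter (\<Delta> k) \<le> b * setdist (\<Delta> k) (frontier upper_halfspace))) \<and>
         (\<Union>k\<in>{1..}. \<Delta>' k) = upper_halfspace \<and>
         (\<exists>N. \<forall>z\<in>upper_halfspace. finite {k. k \<ge> 1 \<and> z \<in> \<Delta>' k} \<and> card {k. k \<ge> 1 \<and> z \<in> \<Delta>' k} \<le> N) \<and>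
         (\<exists>a b. 0 < a \<and> 0 < b \<and> (\<forall>k\<ge>1. \<forall>(x, t)\<in>\<Delta>' k. a * \<eta> k \<le> t \<and> t \<le> b * \<eta> k)))"

end

theory Submission
  imports Defs
begin

text \<open>
  Write \<open>n = CARD('n)\<close> and let \<open>Q\<close> be a Whitney cube with centre \<open>(\<xi>, \<eta>)\<close>; its side length and
  the heights of its points are all comparable to \<open>\<eta>\<close>.

  \<^emph>\<open>The Carleson condition implies the embedding.\<close> A harmonic function \<open>f\<close> satisfies the sub-mean
  value inequality for \<open>\<bar>f\<bar> powr \<tau>\<close> with any \<open>\<tau> > 0\<close> (\<open>harmonic_powr_submean\<close>). On \<open>Q\<close> it bounds
  \<open>\<eta> powr (n + \<alpha> p) * \<bar>f\<bar> powr p\<close> by the part of \<open>TL_norm p \<tau> \<alpha> f powr p\<close> that comes from the enlarged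
  cube (\<open>harmonic_powr_le_local_TL\<close>). The Carleson condition therefore bounds the integral of
  \<open>\<bar>f\<bar> powr p\<close> over \<open>Q\<close> by the same local quantity. The local quantities add up to at most a constant
  times \<open>TL_norm p \<tau> \<alpha> f powr p\<close>, because \<open>p / \<tau> \<ge> 1\<close> and the enlarged cubes overlap finitely
  (\<open>Lp_norm_le_TL_norm\<close>).

  The mean value property behind this is proved for averages against the weight
  \<open>max 0 (1 - \<bar>y\<bar>\<^sup>2)\<close> on a ball (\<open>harmonic_bump_mean_value\<close>). For this weight the derivative of the
  average with respect to the radius is the integral of the divergence of a compactly supported field,
  which vanishes by translation invariance; neither surface integrals nor polar coordinates occur.

  \<^emph>\<open>The embedding implies the Carleson condition.\<close> For every point \<open>(x0, t0)\<close> there is a harmonic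
  function bounded away from zero on the ball with centre \<open>(x0, t0)\<close> and radius proportional to \<open>t0\<close>, whose
  Triebel-Lizorkin norm to the power \<open>p\<close> is at most a constant times \<open>t0 powr (n + \<alpha> p)\<close>
  (\<open>test_functions\<close>). The embedding bounds the measure of that ball accordingly, and boundedly many of
  these balls cover \<open>Q\<close> (\<open>carleson_if_embedded\<close>). Small exponents require test functions of
  arbitrarily fast decay. They are Kelvin transforms of the harmonic polynomials \<open>Re ((t + \<i> x\<^sub>b) ^ m)\<close>,
  where \<open>x\<^sub>b\<close> is one of the horizontal coordinates (\<open>harmonic_kelvin_power\<close>).\<close>

section \<open>A mean value property of harmonic functions\<close>

lemma norm_le_1_imp_unit_cube: "norm y \<le> 1 \<Longrightarrow> y \<in> cbox (-One) (One::'a::euclidean_space)"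
  by (auto simp: mem_box) (smt (verit) Basis_le_norm)+

text \<open>A divergence theorem without boundary terms: by translation invariance the integral of
  \<open>g (y + h b)\<close> over \<open>y\<close> does not depend on \<open>h\<close>, and its derivative at \<open>h = 0\<close> is the integral
  in question.\<close>

lemma integral_directional_derivative_eq_0:
  fixes g g' :: "'a::euclidean_space \<Rightarrow> real"
  assumes b: "b \<in> Basis"
    and deriv: "\<And>y. ((\<lambda>s. g (y + s *\<^sub>R b)) has_real_derivative g' y) (at 0)"
    and cont: "continuous_on UNIV g" "continuous_on UNIV g'"
    and supp: "\<And>y. norm y > 1 \<Longrightarrow> g y = 0" "\<And>y. norm y > 1 \<Longrightarrow> g' y = 0"
  shows "integral (cbox (-One) One) g' = 0"
proof -
  let ?Q = "cbox (-One) (One::'a)"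
  \<comment> \<open>the doubled cube contains the supports of all translates with \<open>\<bar>h\<bar> \<le> 1\<close>\<close>
  let ?Q2 = "cbox (-2 *\<^sub>R One) (2 *\<^sub>R One::'a)"
  have outQ: "norm y > 1" if "y \<notin> ?Q" for y :: 'a
    using that norm_le_1_imp_unit_cube by (metis not_le)
  let ?G = "\<lambda>h. integral ?Q2 (\<lambda>y. g (y + h *\<^sub>R b))"
  have const: "?G h = integral ?Q g" if h: "h \<in> {-1..1}" for h
  proof -
    have "(g has_integral integral ?Q g) ?Q"
      by (intro integrable_integral integrable_continuous continuous_on_subset[OF cont(1)]) auto
    then have "((\<lambda>y. g (y + h *\<^sub>R b)) has_integral integral ?Q g)
        (cbox (-One - h *\<^sub>R b) (One - h *\<^sub>R b))"
      by (rule has_integral_shift_cbox)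
    then have "((\<lambda>y. g (y + h *\<^sub>R b)) has_integral integral ?Q g) ?Q2"
    proof (rule has_integral_on_superset)
      fix y assume "y \<notin> cbox (-One - h *\<^sub>R b) (One - h *\<^sub>R b)"
      then have "y + h *\<^sub>R b \<notin> ?Q"
        by (auto simp: mem_box algebra_simps)
      then show "g (y + h *\<^sub>R b) = 0" using outQ supp(1) by blast
    next
      show "cbox (-One - h *\<^sub>R b) (One - h *\<^sub>R b) \<subseteq> ?Q2"
        using h b by (auto simp: mem_box inner_diff_left inner_Basis)
          (drule (1) bspec, simp split: if_splits)+
    qed
    then show ?thesis by (rule integral_unique)
  qed
  have "(?G has_real_derivative integral ?Q2 (\<lambda>y. g' (y + 0 *\<^sub>R b))) (at 0 within {-1..1})"
  proof (rule leibniz_rule_field_derivative)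
    fix h :: real and y :: 'a
    have "((\<lambda>s. g ((y + h *\<^sub>R b) + (s + - h) *\<^sub>R b)) has_real_derivative g' (y + h *\<^sub>R b)) (at (0 + h))"
      using deriv[of "y + h *\<^sub>R b"]
      by (subst DERIV_shift) (simp add: algebra_simps)
    then show "((\<lambda>s. g (y + s *\<^sub>R b)) has_real_derivative g' (y + h *\<^sub>R b)) (at h within {-1..1})"
      by (simp add: algebra_simps has_field_derivative_at_within)
  next
    show "(\<lambda>y. g (y + h *\<^sub>R b)) integrable_on ?Q2" for h
      by (intro integrable_continuous continuous_on_compose2[OF cont(1)] continuous_intros) auto
    show "continuous_on ({-1..1} \<times> ?Q2) (\<lambda>(h, y). g' (y + h *\<^sub>R b))"
      unfolding split_beta
      by (intro continuous_on_compose2[OF cont(2)] continuous_intros) auto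
  qed auto
  moreover have "(?G has_real_derivative 0) (at 0 within {-1..1})"
    by (rule has_field_derivative_transform_within[where f="\<lambda>_. integral ?Q g" and d=1])
      (use const in auto)
  moreover have "at (0::real) within {-1..1} = at 0"
    by (rule at_within_interior) auto
  ultimately have "integral ?Q2 g' = 0"
    by (metis (no_types, lifting) DERIV_unique scaleR_zero_left add_0_right integral_cong)
  moreover have "(g' has_integral integral ?Q g') ?Q2"
  proof (rule has_integral_on_superset)
    show "(g' has_integral integral ?Q g') ?Q"
      by (intro integrable_integral integrable_continuous continuous_on_subset[OF cont(2)]) auto
    show "?Q \<subseteq> ?Q2" by (auto simp: mem_box) (drule (1) bspec, simp)+
  qed (use outQ supp(2) in blast)
  ultimately show ?thesis by (simp add: integral_unique)
qed

lemma DERIV_sq_pos_part: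
  "((\<lambda>s::real. (max 0 s)\<^sup>2) has_real_derivative 2 * max 0 s) (at s)"
proof -
  consider "s < 0" | "s > 0" | "s = 0" by linarith
  then show ?thesis
  proof cases
    case 1
    have "((\<lambda>s::real. 0) has_real_derivative 0) (at s)" by simp
    then have "((\<lambda>s::real. (max 0 s)\<^sup>2) has_real_derivative 0) (at s)"
      by (rule has_field_derivative_transform_within_open[where S="{..<0}"]) (use 1 in auto)
    then show ?thesis using 1 by simp
  next
    case 2
    have "((\<lambda>s::real. s\<^sup>2) has_real_derivative 2 * s) (at s)"
      by (auto intro!: derivative_eq_intros)
    then have "((\<lambda>s::real. (max 0 s)\<^sup>2) has_real_derivative 2 * s) (at s)"
      by (rule has_field_derivative_transform_within_open[where S="{0<..}"]) (use 2 in auto)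
    then show ?thesis using 2 by simp
  next
    case 3
    have "((\<lambda>h::real. ((max 0 (0 + h))\<^sup>2 - (max 0 0)\<^sup>2) / h) \<longlongrightarrow> 0) (at 0)"
    proof (rule Lim_null_comparison)
      show "\<forall>\<^sub>F h::real in at 0. norm (((max 0 (0 + h))\<^sup>2 - (max 0 0)\<^sup>2) / h) \<le> \<bar>h\<bar>"
        by (auto simp: eventually_at power2_eq_square max_def intro!: exI[of _ 1])
      show "((\<lambda>h::real. \<bar>h\<bar>) \<longlongrightarrow> 0) (at 0)"
        by (intro tendsto_rabs_zero tendsto_ident_at)
    qed
    then show ?thesis using 3 by (simp add: DERIV_def)
  qed
qed

text \<open>An average against this radial weight replaces the average over a ball or a sphere: it is
  supported in the unit ball, and \<open>y \<mapsto> bump y *\<^sub>R y\<close> is, up to sign, the gradient of the \<open>C\<^sup>1\<close>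
  function \<open>bump\<^sup>2 / 4\<close>.\<close>

definition bump :: "'a::euclidean_space \<Rightarrow> real" where
  "bump y = max 0 (1 - y \<bullet> y)"

lemma bump_eq_0: "norm y \<ge> 1 \<Longrightarrow> bump y = 0"
  by (simp add: bump_def dot_square_norm[symmetric] power_le_one_iff max_def abs_square_le_1)
   (metis dot_square_norm one_le_power order_antisym)

lemma bump_nonneg: "0 \<le> bump y" by (simp add: bump_def)
lemma bump_le_1: "bump y \<le> 1" by (simp add: bump_def)

lemma continuous_on_bump [continuous_intros]: "continuous_on S bump"
  unfolding bump_def by (intro continuous_intros)

lemma bump_sq_has_derivative:
  "((\<lambda>y. (bump y)\<^sup>2 / 4) has_derivative (\<lambda>h. - bump y * (y \<bullet> h))) (at y)"
proof -
  have "((\<lambda>y. (max 0 (1 - y \<bullet> y))\<^sup>2) has_derivative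
     (\<lambda>h. - (h \<bullet> y + y \<bullet> h) * (2 * max 0 (1 - y \<bullet> y)))) (at y)"
    by (rule has_derivative_compose[where g = "\<lambda>s. (max 0 s)\<^sup>2" and f = "\<lambda>y. 1 - y \<bullet> y",
          OF _ DERIV_sq_pos_part[unfolded has_field_derivative_def], THEN has_derivative_eq_rhs])
       (auto intro!: derivative_eq_intros simp: fun_eq_iff)
  then have "((\<lambda>y. (1/4) * (max 0 (1 - y \<bullet> y))\<^sup>2) has_derivative
     (\<lambda>h. (1/4) * (- (h \<bullet> y + y \<bullet> h) * (2 * max 0 (1 - y \<bullet> y))))) (at y)"
    by (rule has_derivative_mult_right)
  then show ?thesis
    by (rule has_derivative_eq_rhs[OF has_derivative_transform[rotated 2]])
      (auto simp: bump_def fun_eq_iff inner_commute)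
qed

lemma isCont_bump: "isCont bump (y::'a::euclidean_space)"
  using continuous_on_bump[of "UNIV::'a set"] by (simp add: continuous_on_eq_continuous_at)

text \<open>In the applications \<open>k\<close> involves derivatives of a function that is harmonic near the closed unit
  ball only; the product with the bump is continuous everywhere all the same.\<close>

lemma isCont_bump_mult:
  assumes "norm y \<le> 1 \<Longrightarrow> isCont k y"
  shows "isCont (\<lambda>y. bump y * k y) y"
proof (cases "norm y \<le> 1")
  case True
  with assms show ?thesis by (intro continuous_mult isCont_bump)
next
  case False
  have "\<forall>\<^sub>F x in nhds y. bump x * k x = 0"
    by (rule eventually_mono[OF eventually_nhds_in_open[of "{x. norm x > 1}" y]])
      (use False in \<open>auto simp: bump_eq_0 intro!: open_Collect_less continuous_intros\<close>)
  then show ?thesis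
    by (subst isCont_cong[where g="\<lambda>_. 0"]) auto
qed

text \<open>Here \<open>D\<close> and \<open>H\<close> are the first and second derivatives of a harmonic function \<open>f\<close>. With
  \<open>\<psi> = bump\<^sup>2 / 4\<close> the integrand is minus the divergence of the compactly supported field
  \<open>\<psi> y *\<^sub>R grad f (z + \<rho> y)\<close>: differentiating \<open>\<psi>\<close> produces \<open>- bump y *\<^sub>R y\<close>, and the term with the
  second derivatives of \<open>f\<close> is \<open>\<rho> * \<psi> y\<close> times the Laplacian.\<close>

lemma integral_bump_radial_derivative_eq_0:
  fixes D :: "'a::euclidean_space \<Rightarrow> 'a \<Rightarrow>\<^sub>L real" and H :: "'a \<Rightarrow> 'a \<Rightarrow>\<^sub>L ('a \<Rightarrow>\<^sub>L real)"
  assumes S: "open S" "\<And>y. norm y \<le> 1 \<Longrightarrow> z + \<rho> *\<^sub>R y \<in> S"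
    and D: "\<And>w. w \<in> S \<Longrightarrow> (D has_derivative blinfun_apply (H w)) (at w)"
    and H: "continuous_on S H"
    and trace: "\<And>w. w \<in> S \<Longrightarrow> (\<Sum>b\<in>Basis. H w b b) = 0"
  shows "integral (cbox (-One) One) (\<lambda>y. bump y * D (z + \<rho> *\<^sub>R y) y) = 0"
proof -
  let ?Q = "cbox (-One) (One::'a)"
  let ?p = "\<lambda>y. z + \<rho> *\<^sub>R y"
  define g where "g = (\<lambda>b y. bump y * (bump y * D (?p y) b / 4))"
  define g' where "g' = (\<lambda>b y. bump y * (- (y \<bullet> b) * D (?p y) b + bump y * (\<rho> * H (?p y) b b) / 4))"
  have contD: "isCont (\<lambda>y. D (?p y) b) y" if "norm y \<le> 1" for y b
  proof -
    have "isCont D (?p y)" using D[OF S(2)[OF that]] by (rule has_derivative_continuous)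
    then have "isCont (\<lambda>y. D (?p y)) y"
      by (intro isCont_o2[where f="?p" and g=D]) (auto intro!: continuous_intros)
    then show ?thesis by (intro continuous_intros)
  qed
  have contH: "isCont (\<lambda>y. H (?p y) b b) y" if "norm y \<le> 1" for y b
  proof -
    have "isCont H (?p y)" using H S(1) S(2)[OF that] by (simp add: continuous_on_eq_continuous_at)
    then have "isCont (\<lambda>y. H (?p y)) y"
      by (intro isCont_o2[where f="?p" and g=H]) (auto intro!: continuous_intros)
    then show ?thesis by (intro continuous_intros)
  qed
  have cont_g: "continuous_on UNIV (g b)" for b
    unfolding g_def by (intro continuous_at_imp_continuous_on ballI isCont_bump_mult)
      (intro continuous_intros contD isCont_bump; simp)
  have cont_g': "continuous_on UNIV (g' b)" for b
    unfolding g'_def by (intro continuous_at_imp_continuous_on ballI isCont_bump_mult)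
      (intro continuous_intros contD contH isCont_bump; simp)
  have deriv: "((\<lambda>s. g b (y + s *\<^sub>R b)) has_real_derivative g' b y) (at 0)" for b y
  proof (cases "norm y \<le> 1")
    case True
    have bump2: "((\<lambda>s. (bump (y + s *\<^sub>R b))\<^sup>2 / 4) has_derivative (\<lambda>s. - bump y * (y \<bullet> (s *\<^sub>R b)))) (at 0)"
      by (rule has_derivative_compose[where g = "\<lambda>y. (bump y)\<^sup>2 / 4"])
        (use bump_sq_has_derivative[of y] in \<open>auto intro!: derivative_eq_intros\<close>)
    have "((\<lambda>s. D (?p (y + s *\<^sub>R b))) has_derivative (\<lambda>s. H (?p y) (\<rho> *\<^sub>R (s *\<^sub>R b)))) (at 0)"
      by (rule has_derivative_compose[where g = D])
        (use D[OF S(2)[OF True]] in \<open>auto intro!: derivative_eq_intros\<close>)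
    then have "((\<lambda>s. D (?p (y + s *\<^sub>R b)) b) has_derivative (\<lambda>s. H (?p y) (\<rho> *\<^sub>R (s *\<^sub>R b)) b)) (at 0)"
      by (rule bounded_linear.has_derivative[OF blinfun.bounded_linear_left])
    from has_derivative_mult[OF bump2 this]
    show ?thesis
      unfolding has_field_derivative_def g_def g'_def
      by (rule has_derivative_eq_rhs[OF has_derivative_transform[rotated 2]])
        (auto simp: fun_eq_iff power2_eq_square algebra_simps blinfun.bilinear_simps)
  next
    case False
    have "((\<lambda>s. 0) has_real_derivative 0) (at 0)" by simp
    moreover have "open ((\<lambda>s. norm (y + s *\<^sub>R b)) -` {1<..})"
      by (intro open_vimage continuous_intros)
    ultimately have "((\<lambda>s. g b (y + s *\<^sub>R b)) has_real_derivative 0) (at 0)"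
      by (rule has_field_derivative_transform_within_open) (use False in \<open>auto simp: g_def bump_eq_0\<close>)
    then show ?thesis using False by (simp add: g'_def bump_eq_0)
  qed
  \<comment> \<open>\<open>g b\<close> is the \<open>b\<close>-th component of the field, and \<open>g' b\<close> its derivative in direction \<open>b\<close>\<close>
  have zero: "integral ?Q (g' b) = 0" if "b \<in> Basis" for b
    by (rule integral_directional_derivative_eq_0[OF that deriv cont_g cont_g'])
      (auto simp: g_def g'_def bump_eq_0)
  have "bump y * D (?p y) y = - (\<Sum>b\<in>Basis. g' b y)" for y
  proof (cases "norm y \<le> 1")
    case True
    have "(\<Sum>b\<in>Basis. g' b y)
        = bump y * (- (\<Sum>b\<in>Basis. (y \<bullet> b) * D (?p y) b) + bump y * \<rho> / 4 * (\<Sum>b\<in>Basis. H (?p y) b b))"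
      by (simp add: g'_def sum.distrib sum_distrib_left sum_negf algebra_simps sum_divide_distrib sum_subtractf)
    also have "(\<Sum>b\<in>Basis. (y \<bullet> b) * D (?p y) b) = D (?p y) (\<Sum>b\<in>Basis. (y \<bullet> b) *\<^sub>R b)"
      by (simp add: blinfun.sum_right blinfun.scaleR_right)
    also have "\<dots> = D (?p y) y" by (simp add: euclidean_representation)
    finally show ?thesis using trace[OF S(2)[OF True]] by simp
  qed (simp add: g'_def bump_eq_0)
  then have "integral ?Q (\<lambda>y. bump y * D (?p y) y) = - integral ?Q (\<lambda>y. \<Sum>b\<in>Basis. g' b y)"
    by simp
  also have "integral ?Q (\<lambda>y. \<Sum>b\<in>Basis. g' b y) = (\<Sum>b\<in>Basis. integral ?Q (g' b))"
    by (intro integral_sum finite_Basis integrable_continuous continuous_on_subset[OF cont_g']) auto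
  finally show ?thesis by (simp add: zero)
qed

text \<open>The weighted averages of \<open>f\<close> over the cubes of half side \<open>\<rho>\<close> have derivative zero in \<open>\<rho>\<close>, so the
  average for \<open>\<rho> = r\<close> is the one for \<open>\<rho> = 0\<close>.\<close>

lemma harmonic_bump_mean_value:
  fixes f :: "'a::euclidean_space \<Rightarrow> real"
  assumes f: "harmonic_on f S" and S: "open S" and r: "r \<ge> 0"
    and sub: "\<And>\<rho> y. \<rho> \<in> {0..r} \<Longrightarrow> y \<in> cbox (-One) One \<Longrightarrow> z + \<rho> *\<^sub>R y \<in> S"
  shows "f z * integral (cbox (-One) One) (bump :: 'a \<Rightarrow> real)
       = integral (cbox (-One) One) (\<lambda>y. bump y * f (z + r *\<^sub>R y))"
proof -
  let ?Q = "cbox (-One) (One::'a)"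
  from f obtain D :: "'a \<Rightarrow> 'a \<Rightarrow>\<^sub>L real" and H :: "'a \<Rightarrow> 'a \<Rightarrow>\<^sub>L ('a \<Rightarrow>\<^sub>L real)" where
    fD: "\<And>w. w \<in> S \<Longrightarrow> (f has_derivative blinfun_apply (D w)) (at w)" and
    DH: "\<And>w. w \<in> S \<Longrightarrow> (D has_derivative blinfun_apply (H w)) (at w)" and
    H: "continuous_on S H" and trace: "\<And>w. w \<in> S \<Longrightarrow> (\<Sum>b\<in>Basis. H w b b) = 0"
    unfolding harmonic_on_def by blast
  have contf: "continuous_on S f"
    by (intro continuous_at_imp_continuous_on ballI has_derivative_continuous[OF fD])
  have contD: "continuous_on S D"
    by (intro continuous_at_imp_continuous_on ballI has_derivative_continuous[OF DH])
  let ?u = "\<lambda>\<rho>. integral ?Q (\<lambda>y. bump y * f (z + \<rho> *\<^sub>R y))"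
  have deriv: "(?u has_real_derivative integral ?Q (\<lambda>y. bump y * D (z + \<rho> *\<^sub>R y) y)) (at \<rho> within {0..r})"
    if "\<rho> \<in> {0..r}" for \<rho>
  proof (rule leibniz_rule_field_derivative)
    fix \<rho> y assume *: "\<rho> \<in> {0..r}" "y \<in> ?Q"
    have "((\<lambda>\<rho>. f (z + \<rho> *\<^sub>R y)) has_derivative (\<lambda>s. D (z + \<rho> *\<^sub>R y) (s *\<^sub>R y))) (at \<rho>)"
      by (rule has_derivative_compose[where g=f])
         (use fD[OF sub[OF *]] in \<open>auto intro!: derivative_eq_intros\<close>)
    then have "((\<lambda>\<rho>. f (z + \<rho> *\<^sub>R y)) has_real_derivative D (z + \<rho> *\<^sub>R y) y) (at \<rho>)"
      unfolding has_field_derivative_def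
      by (rule has_derivative_eq_rhs) (auto simp: blinfun.scaleR_right fun_eq_iff)
    then show "((\<lambda>\<rho>. bump y * f (z + \<rho> *\<^sub>R y)) has_real_derivative bump y * D (z + \<rho> *\<^sub>R y) y)
        (at \<rho> within {0..r})"
      by (rule has_field_derivative_at_within[OF DERIV_cmult])
  next
    fix \<rho> assume *: "\<rho> \<in> {0..r}"
    show "(\<lambda>y. bump y * f (z + \<rho> *\<^sub>R y)) integrable_on ?Q"
      by (intro integrable_continuous continuous_intros continuous_on_compose2[OF contf])
        (use sub[OF *] in auto)
  next
    show "continuous_on ({0..r} \<times> ?Q) (\<lambda>(\<rho>, y). bump y * D (z + \<rho> *\<^sub>R y) y)"
      unfolding split_beta
      by (intro continuous_intros continuous_on_compose2[OF contD]
            continuous_on_compose2[OF continuous_on_bump[of UNIV]])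
        (use sub in auto)
  qed (use that in auto)
  have "(?u has_real_derivative 0) (at \<rho> within {0..r})" if "\<rho> \<in> {0..r}" for \<rho>
  proof -
    have "integral ?Q (\<lambda>y. bump y * D (z + \<rho> *\<^sub>R y) y) = 0"
      by (rule integral_bump_radial_derivative_eq_0[OF S _ DH H trace])
        (use sub[OF that] norm_le_1_imp_unit_cube in auto)
    with deriv[OF that] show ?thesis by simp
  qed
  then have "\<exists>c. \<forall>\<rho>\<in>{0..r}. ?u \<rho> = c"
    by (intro has_field_derivative_zero_constant) auto
  then obtain c where "\<forall>\<rho>\<in>{0..r}. ?u \<rho> = c" ..
  then have "?u r = c" "?u 0 = c" using r by (simp_all del: scaleR_zero_left)
  then show ?thesis by (simp add: mult.commute)
qed

section \<open>Sub-mean value property for powers\<close>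

lemma mem_cube: "w \<in> cube z l \<longleftrightarrow> (\<forall>b\<in>Basis. \<bar>(w - z) \<bullet> b\<bar> \<le> l / 2)"
  unfolding cube_def mem_box
  by (intro ball_cong refl, subst abs_le_iff) (auto simp: inner_diff_left inner_add_left)

lemma cube_mono: "l \<le> l' \<Longrightarrow> cube c l \<subseteq> cube c l'"
  unfolding subset_iff mem_cube by (meson divide_right_mono order_trans zero_le_numeral)

lemma cube_subset_cball:
  fixes z :: "'a::euclidean_space" and \<rho> r :: real
  shows "\<rho> * DIM('a) \<le> r \<Longrightarrow> cube z (2 * \<rho>) \<subseteq> cball z r"
proof
  fix w assume *: "\<rho> * DIM('a) \<le> r" "w \<in> cube z (2 * \<rho>)"
  have "norm (w - z) \<le> (\<Sum>b\<in>Basis. \<bar>(w - z) \<bullet> b\<bar>)" by (rule norm_le_l1)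
  also have "\<dots> \<le> (\<Sum>b\<in>(Basis::'a set). \<rho>)" using * by (intro sum_mono) (auto simp: mem_cube)
  also have "\<dots> \<le> r" using * by (simp add: mult.commute)
  finally show "w \<in> cball z r" by (simp add: dist_norm norm_minus_commute)
qed

lemma integral_bump_pos: "integral (cbox (-One) One) (bump :: 'a::euclidean_space \<Rightarrow> real) > 0"
proof -
  have "integral (cbox (-One) One) (bump :: 'a \<Rightarrow> real) \<noteq> 0"
  proof
    assume "integral (cbox (-One) One) (bump :: 'a \<Rightarrow> real) = 0"
    then have "\<forall>x\<in>cbox (-One) One. bump (x::'a) = 0"
      by (subst (asm) integral_cbox_eq_0_iff)
        (auto simp: bump_nonneg box_ne_empty intro!: continuous_intros)
    moreover have "(0::'a) \<in> cbox (-One) One" by (auto simp: mem_box)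
    ultimately show False by (auto simp: bump_def)
  qed
  moreover have "integral (cbox (-One) One) (bump :: 'a \<Rightarrow> real) \<ge> 0"
    by (intro integral_nonneg integrable_continuous continuous_intros) (auto simp: bump_nonneg)
  ultimately show ?thesis by simp
qed

lemma harmonic_on_imp_continuous_on:
  assumes "harmonic_on f S" shows "continuous_on S f"
proof (intro continuous_at_imp_continuous_on ballI)
  fix z assume "z \<in> S"
  with assms obtain f' where "(f has_derivative f') (at z)"
    unfolding harmonic_on_def by metis
  then show "isCont f z" by (rule has_derivative_continuous)
qed

lemma harmonic_abs_le_cube_mean:
  fixes f :: "'a::euclidean_space \<Rightarrow> real"
  assumes f: "harmonic_on f S" and S: "open S" and r: "r > 0" and sub: "cube z (2 * r) \<subseteq> S"
  shows "integral (cbox (-One) One) (bump :: 'a \<Rightarrow> real) * r ^ DIM('a) * \<bar>f z\<bar>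
       \<le> integral (cube z (2 * r)) (\<lambda>w. \<bar>f w\<bar>)"
proof -
  let ?Q = "cbox (-One) (One::'a)" and ?C = "cube z (2 * r)"
  have in_cube: "z + \<rho> *\<^sub>R y \<in> ?C" if "\<rho> \<in> {0..r}" "y \<in> ?Q" for \<rho> y
  proof -
    have "\<bar>\<rho> * (y \<bullet> b)\<bar> \<le> r * 1" if "b \<in> Basis" for b
      unfolding abs_mult using \<open>\<rho> \<in> _\<close> \<open>y \<in> ?Q\<close> that
      by (intro mult_mono) (auto simp: mem_box abs_le_iff)
    then show ?thesis by (simp add: mem_cube)
  qed
  have cont: "continuous_on S f" by (rule harmonic_on_imp_continuous_on[OF f])
  have "((\<lambda>w. \<bar>f w\<bar>) has_integral integral ?C (\<lambda>w. \<bar>f w\<bar>)) ?C"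
    unfolding cube_def by (intro integrable_integral integrable_continuous continuous_intros
      continuous_on_subset[OF cont sub[unfolded cube_def]])
  then have "((\<lambda>y. \<bar>f (r *\<^sub>R y + z)\<bar>) has_integral (integral ?C (\<lambda>w. \<bar>f w\<bar>) /\<^sub>R r ^ DIM('a)))
      (cbox ((z - (2 * r / 2) *\<^sub>R One - z) /\<^sub>R r) ((z + (2 * r / 2) *\<^sub>R One - z) /\<^sub>R r))"
    unfolding cube_def by (rule has_integral_affinity'[OF _ r])
  then have I: "((\<lambda>y. \<bar>f (z + r *\<^sub>R y)\<bar>) has_integral (integral ?C (\<lambda>w. \<bar>f w\<bar>) / r ^ DIM('a))) ?Q"
    using r by (simp add: add.commute[of _ z] field_simps)
  have "\<bar>f z\<bar> * integral ?Q bump = \<bar>f z * integral ?Q bump\<bar>"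
    using integral_bump_pos[where 'a='a] by (simp add: abs_mult)
  also have "f z * integral ?Q bump = integral ?Q (\<lambda>y. bump y * f (z + r *\<^sub>R y))"
    by (rule harmonic_bump_mean_value[OF f S]) (use r sub in_cube in auto)
  also have "\<bar>\<dots>\<bar> \<le> integral ?Q (\<lambda>y. \<bar>f (z + r *\<^sub>R y)\<bar>)"
    unfolding real_norm_def[symmetric]
  proof (rule integral_norm_bound_integral)
    show "(\<lambda>y. bump y * f (z + r *\<^sub>R y)) integrable_on ?Q"
      by (intro integrable_continuous continuous_intros continuous_on_compose2[OF cont])
        (use sub in_cube r in auto)
    show "(\<lambda>y. norm (f (z + r *\<^sub>R y))) integrable_on ?Q" using I by (auto simp: integrable_on_def)
    show "norm (bump y * f (z + r *\<^sub>R y)) \<le> norm (f (z + r *\<^sub>R y))" for y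
      by (simp add: abs_mult bump_nonneg mult_left_le_one_le bump_le_1)
  qed
  also have "\<dots> = integral ?C (\<lambda>w. \<bar>f w\<bar>) / r ^ DIM('a)" by (rule integral_unique[OF I])
  finally show ?thesis using r by (simp add: field_simps)
qed

lemma powr_le_sum_endpoints:
  fixes u v y e :: real
  assumes "0 < u" "u \<le> y" "y \<le> v"
  shows "y powr e \<le> u powr e + v powr e"
proof (cases "0 \<le> e")
  case True
  then have "y powr e \<le> v powr e" using assms by (intro powr_mono2) auto
  then show ?thesis by (smt (verit) powr_ge_zero)
next
  case False
  then have "y powr e \<le> u powr e" using assms by (intro powr_mono2') auto
  then show ?thesis by (smt (verit) powr_ge_zero)
qed

text \<open>Where \<open>y \<le> \<delta> a\<close> the linear term suffices; elsewhere \<open>y\<close> lies between \<open>\<delta> a\<close> and \<open>L a\<close>, hence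
  \<open>y powr (1 - \<tau>)\<close> is at most a constant times \<open>a powr (1 - \<tau>)\<close>. For \<open>\<tau> < 1\<close> the upper bound
  enters, for \<open>\<tau> > 1\<close> the lower one, so one inequality serves all exponents.\<close>

lemma le_linear_plus_powr:
  fixes a y \<delta> L \<tau> :: real
  assumes "0 < a" "0 < \<delta>" "0 < \<tau>" "0 < L" "0 \<le> y" "y \<le> L * a"
  shows "y \<le> \<delta> * a + (\<delta> powr (1 - \<tau>) + L powr (1 - \<tau>)) * a powr (1 - \<tau>) * y powr \<tau>"
proof (cases "y \<le> \<delta> * a")
  case True
  then show ?thesis by (smt (verit, best) mult_nonneg_nonneg powr_ge_zero)
next
  case False
  then have y: "y > 0" "\<delta> * a \<le> y" using assms by (smt (verit) mult_pos_pos)+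
  have "y powr (1 - \<tau>) \<le> (\<delta> * a) powr (1 - \<tau>) + (L * a) powr (1 - \<tau>)"
    using assms y by (intro powr_le_sum_endpoints) auto
  also have "\<dots> = (\<delta> powr (1 - \<tau>) + L powr (1 - \<tau>)) * a powr (1 - \<tau>)"
    using assms by (simp add: powr_mult algebra_simps)
  finally have "y powr (1 - \<tau>) * y powr \<tau> \<le> (\<delta> powr (1 - \<tau>) + L powr (1 - \<tau>)) * a powr (1 - \<tau>) * y powr \<tau>"
    by (rule mult_right_mono) simp
  moreover have "y powr (1 - \<tau>) * y powr \<tau> = y" using y by (simp flip: powr_add)
  moreover have "0 \<le> \<delta> * a" using assms by simp
  ultimately show ?thesis by linarith
qed

lemma integral_const_cube: "r \<ge> 0 \<Longrightarrow> ((\<lambda>_. c) has_integral c * (2 * r) ^ DIM('a)) (cube (z::'a::euclidean_space) (2 * r))"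
proof -
  assume r: "r \<ge> 0"
  have "((\<lambda>_. c) has_integral measure lborel (cube z (2 * r)) *\<^sub>R c) (cube z (2 * r))"
    unfolding cube_def by (rule has_integral_const)
  moreover have "measure lborel (cube z (2 * r)) = (2 * r) ^ DIM('a)"
    unfolding cube_def using r by (subst content_cbox) (auto simp: inner_diff_left inner_add_left algebra_simps)
  ultimately show ?thesis by (simp add: mult.commute)
qed

lemma continuous_on_abs_powr:
  fixes f :: "'a::topological_space \<Rightarrow> real"
  shows "continuous_on S f \<Longrightarrow> \<tau> > 0 \<Longrightarrow> continuous_on S (\<lambda>w. \<bar>f w\<bar> powr \<tau>)"
  by (rule continuous_on_powr'[OF continuous_on_rabs continuous_on_const]) auto

text \<open>The sub-mean value property of Hardy and Littlewood. For \<open>\<tau> \<ge> 1\<close> it is a consequence of convexity,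
  but for \<open>\<tau> < 1\<close> the function \<open>\<bar>f\<bar> powr \<tau>\<close> need not be subharmonic. Choose a point \<open>w\<close> of the ball
  that maximises \<open>\<bar>f\<bar> powr \<tau>\<close> weighted by a power of the distance to the boundary sphere. Close to
  \<open>w\<close> the values of \<open>\<bar>f\<bar>\<close> are at most a constant times \<open>\<bar>f w\<bar>\<close>, so the mean value inequality at
  \<open>w\<close> bounds \<open>\<bar>f w\<bar>\<close> by a small multiple of itself plus \<open>\<bar>f w\<bar> powr (1 - \<tau>)\<close> times an average of
  \<open>\<bar>f\<bar> powr \<tau>\<close>. Maximality carries the resulting bound from \<open>w\<close> over to the centre \<open>z\<close>.\<close>

lemma harmonic_powr_submean:
  fixes \<tau> :: real
  assumes \<tau>: "\<tau> > 0"
  obtains K where "K > 0"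
    and "\<And>(f :: 'a::euclidean_space \<Rightarrow> real) S z r. harmonic_on f S \<Longrightarrow> open S \<Longrightarrow> r > 0 \<Longrightarrow>
      cball z r \<subseteq> S \<Longrightarrow>
      ennreal (r ^ DIM('a) * \<bar>f z\<bar> powr \<tau>) \<le> ennreal K * (\<integral>\<^sup>+w\<in>cball z r. ennreal (\<bar>f w\<bar> powr \<tau>) \<partial>lborel)"
proof -
  let ?N = "DIM('a)"
  define c where "c = integral (cbox (-One) One) (bump :: 'a \<Rightarrow> real)"
  have c: "c > 0" unfolding c_def by (rule integral_bump_pos)
  define L where "L = (2 ^ ?N :: real) powr (1 / \<tau>)"
  have L: "L > 0" by (simp add: L_def)
  \<comment> \<open>makes the linear term, integrated over the cube, half of the left-hand side \<open>c * \<rho> ^ ?N * a\<close>\<close>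
  define \<delta> where "\<delta> = c / 2 ^ (?N + 1)"
  have \<delta>: "\<delta> > 0" using c by (simp add: \<delta>_def)
  define M where "M = \<delta> powr (1 - \<tau>) + L powr (1 - \<tau>)"
  have M: "M > 0" using \<delta> L by (simp add: M_def add_pos_pos)
  define K where "K = (2 * ?N) ^ ?N * (2 * M / c)"
  have K: "K > 0" using c M by (simp add: K_def)
  show thesis
  proof (rule that[OF K])
    fix f :: "'a \<Rightarrow> real" and S z r
    assume f: "harmonic_on f S" and S: "open S" and r: "r > 0" and sub: "cball z r \<subseteq> S"
    have cont: "continuous_on S f" by (rule harmonic_on_imp_continuous_on[OF f])
    let ?I = "\<integral>\<^sup>+w\<in>cball z r. ennreal (\<bar>f w\<bar> powr \<tau>) \<partial>lborel"
    let ?h = "\<lambda>w. (r - dist z w) ^ ?N * \<bar>f w\<bar> powr \<tau>"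
    have "continuous_on (cball z r) ?h"
      by (intro continuous_intros continuous_on_abs_powr continuous_on_subset[OF cont] sub \<tau>)
    then obtain w where w: "w \<in> cball z r" and max: "\<And>\<zeta>. \<zeta> \<in> cball z r \<Longrightarrow> ?h \<zeta> \<le> ?h w"
      using continuous_attains_sup[of "cball z r" ?h] r by auto
    define d where "d = r - dist z w"
    define a where "a = \<bar>f w\<bar>"
    have zw: "r ^ ?N * \<bar>f z\<bar> powr \<tau> \<le> d ^ ?N * a powr \<tau>"
      using max[of z] r by (simp add: d_def a_def)
    show "ennreal (r ^ ?N * \<bar>f z\<bar> powr \<tau>) \<le> ennreal K * ?I"
    proof (cases "d > 0 \<and> a > 0")
      case False
      moreover have "d \<ge> 0" "a \<ge> 0" using w by (auto simp: d_def a_def)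
      ultimately have "d = 0 \<or> a = 0" by auto
      then have "r ^ ?N * \<bar>f z\<bar> powr \<tau> \<le> 0" using zw by (auto simp: zero_power)
      then show ?thesis by (simp add: ennreal_neg)
    next
      case True
      then have d: "d > 0" and a: "a > 0" by auto
      \<comment> \<open>small enough for the cube of half side \<open>\<rho>\<close> around \<open>w\<close> to lie in the ball of radius \<open>d /
          2\<close>\<close>
      define \<rho> where "\<rho> = d / (2 * ?N)"
      have \<rho>: "\<rho> > 0" using d by (simp add: \<rho>_def)
      let ?C = "cube w (2 * \<rho>)"
      have C: "?C \<subseteq> cball w (d / 2)" by (rule cube_subset_cball) (simp add: \<rho>_def)
      have Cdist: "r - dist z \<zeta> \<ge> d / 2" if "\<zeta> \<in> ?C" for \<zeta>
        using C that dist_triangle[of z \<zeta> w] by (auto simp: d_def)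
      have CB: "?C \<subseteq> cball z r" using Cdist d by force
      have bound: "\<bar>f \<zeta>\<bar> \<le> L * a" if \<zeta>: "\<zeta> \<in> ?C" for \<zeta>
      proof -
        have "(d / 2) ^ ?N * \<bar>f \<zeta>\<bar> powr \<tau> \<le> ?h \<zeta>"
          using Cdist[OF \<zeta>] d by (intro mult_right_mono power_mono) auto
        also have "\<dots> \<le> d ^ ?N * a powr \<tau>" using max[of \<zeta>] CB \<zeta> by (auto simp: d_def a_def)
        finally have "\<bar>f \<zeta>\<bar> powr \<tau> \<le> 2 ^ ?N * a powr \<tau>"
          using d by (simp add: power_divide field_simps)
        then have "(\<bar>f \<zeta>\<bar> powr \<tau>) powr (1 / \<tau>) \<le> (2 ^ ?N * a powr \<tau>) powr (1 / \<tau>)"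
          using \<tau> by (intro powr_mono2) auto
        then show ?thesis using \<tau> a by (simp add: powr_powr powr_mult L_def)
      qed
      have contC: "continuous_on ?C f" using CB sub by (intro continuous_on_subset[OF cont]) auto
      define J where "J = integral ?C (\<lambda>\<zeta>. \<bar>f \<zeta>\<bar> powr \<tau>)"
      have J: "((\<lambda>\<zeta>. \<bar>f \<zeta>\<bar> powr \<tau>) has_integral J) ?C"
        unfolding J_def by (intro integrable_integral)
          (use contC \<tau> in \<open>auto simp: cube_def intro!: integrable_continuous continuous_on_abs_powr\<close>)
      have "c * \<rho> ^ ?N * a \<le> integral ?C (\<lambda>\<zeta>. \<bar>f \<zeta>\<bar>)"
        unfolding c_def a_def by (rule harmonic_abs_le_cube_mean[OF f S \<rho>]) (use CB sub in auto)
      also have "\<dots> \<le> \<delta> * a * (2 * \<rho>) ^ ?N + M * a powr (1 - \<tau>) * J"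
      proof (rule has_integral_le)
        show "((\<lambda>\<zeta>. \<bar>f \<zeta>\<bar>) has_integral integral ?C (\<lambda>\<zeta>. \<bar>f \<zeta>\<bar>)) ?C"
          by (intro integrable_integral)
            (use contC in \<open>auto simp: cube_def intro!: integrable_continuous continuous_intros\<close>)
        show "((\<lambda>\<zeta>. \<delta> * a + M * a powr (1 - \<tau>) * \<bar>f \<zeta>\<bar> powr \<tau>) has_integral
            \<delta> * a * (2 * \<rho>) ^ ?N + M * a powr (1 - \<tau>) * J) ?C"
          using \<rho> by (intro has_integral_add integral_const_cube has_integral_mult_right J) auto
        show "\<bar>f \<zeta>\<bar> \<le> \<delta> * a + M * a powr (1 - \<tau>) * \<bar>f \<zeta>\<bar> powr \<tau>" if "\<zeta> \<in> ?C" for \<zeta>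
          unfolding M_def by (rule le_linear_plus_powr) (use a \<delta> \<tau> L bound[OF that] in auto)
      qed
      also have "\<delta> * a * (2 * \<rho>) ^ ?N = c / 2 * \<rho> ^ ?N * a" by (simp add: \<delta>_def power_mult_distrib)
      finally have "c / 2 * \<rho> ^ ?N * a \<le> M * a powr (1 - \<tau>) * J" by (simp add: algebra_simps)
      then have "c / 2 * \<rho> ^ ?N * a * a powr (\<tau> - 1) \<le> M * a powr (1 - \<tau>) * J * a powr (\<tau> - 1)"
        by (rule mult_right_mono) simp
      moreover have "a * a powr (\<tau> - 1) = a powr \<tau>" "a powr (1 - \<tau>) * a powr (\<tau> - 1) = 1"
        using a by (simp_all add: powr_mult_base flip: powr_add)
      ultimately have "c / 2 * \<rho> ^ ?N * a powr \<tau> \<le> M * J"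
        by (metis (no_types, lifting) mult.assoc mult.commute mult.right_neutral)
      then have "\<rho> ^ ?N * a powr \<tau> \<le> 2 * M / c * J" using c by (simp add: field_simps)
      then have "(2 * ?N) ^ ?N * (\<rho> ^ ?N * a powr \<tau>) \<le> (2 * ?N) ^ ?N * (2 * M / c * J)"
        by (rule mult_left_mono) simp
      then have "d ^ ?N * a powr \<tau> \<le> K * J"
        by (simp add: K_def \<rho>_def power_divide mult.assoc)
      with zw have "ennreal (r ^ ?N * \<bar>f z\<bar> powr \<tau>) \<le> ennreal (K * J)" by (intro ennreal_leI) simp
      also have "\<dots> = ennreal K * ennreal J" using K by (simp add: ennreal_mult')
      also have "ennreal J = (\<integral>\<^sup>+w\<in>?C. ennreal (\<bar>f w\<bar> powr \<tau>) \<partial>lborel)"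
        by (rule nn_integral_has_integral_lebesgue'[symmetric, OF _ J]) simp
      also have "\<dots> \<le> ?I"
        by (intro nn_integral_mono mult_left_mono) (use CB in \<open>auto simp: indicator_def\<close>)
      finally show ?thesis by (simp add: mult_left_mono)
    qed
  qed
qed

section \<open>Powers of extended nonnegative reals\<close>

lemma enn_powr_ennreal: "0 \<le> x \<Longrightarrow> enn_powr (ennreal x) r = ennreal (x powr r)"
  by (simp add: enn_powr_def)

lemma enn_powr_top [simp]: "enn_powr top r = top"
  by (simp_all add: enn_powr_def)

lemma enn_powr_0 [simp]: "enn_powr 0 r = 0"
  by (simp add: enn_powr_def)

lemma enn_powr_1 [simp]: "enn_powr a 1 = a"
  by (cases a) (auto simp: enn_powr_ennreal)

lemma enn_powr_mono: "a \<le> b \<Longrightarrow> 0 \<le> r \<Longrightarrow> enn_powr a r \<le> enn_powr b r"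
  by (cases a; cases b) (auto simp: enn_powr_ennreal top_unique intro!: powr_mono2 ennreal_leI)

lemma enn_powr_enn_powr: "enn_powr (enn_powr a r) s = enn_powr a (r * s)"
  by (cases a) (auto simp: enn_powr_ennreal powr_powr)

lemma enn_powr_mult:
  assumes "r > 0" shows "enn_powr (a * b) r = enn_powr a r * enn_powr b r"
proof (cases "a = 0 \<or> b = 0")
  case False
  then show ?thesis
    by (cases a; cases b)
      (auto simp: enn_powr_ennreal powr_mult ennreal_mult_top ennreal_top_mult simp flip: ennreal_mult)
qed auto

lemma measurable_enn_powr [measurable]:
  assumes [measurable]: "f \<in> borel_measurable M"
  shows "(\<lambda>x. enn_powr (f x) r) \<in> borel_measurable M"
proof -
  have "{x \<in> space M. f x = \<infinity>} = f -` {\<infinity>} \<inter> space M" by auto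
  also have "\<dots> \<in> sets M" by measurable
  finally show ?thesis unfolding enn_powr_def by (intro measurable_If) measurable
qed

lemma enn_powr_superadditive:
  assumes r: "1 \<le> r" shows "enn_powr a r + enn_powr b r \<le> enn_powr (a + b) r"
proof (cases "a = top \<or> b = top")
  case False
  then obtain x y where xy: "a = ennreal x" "b = ennreal y" "0 \<le> x" "0 \<le> y"
    by (cases a; cases b) auto
  have *: "u powr r \<le> u * (x + y) powr (r - 1)" if "0 \<le> u" "u \<le> x + y" for u
  proof (cases "u = 0")
    case False
    then have "u powr r = u * u powr (r - 1)" using that by (simp add: powr_mult_base)
    also have "\<dots> \<le> u * (x + y) powr (r - 1)" using that r by (intro mult_left_mono powr_mono2) auto
    finally show ?thesis .
  qed simp
  have "x powr r + y powr r \<le> (x + y) * (x + y) powr (r - 1)"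
    using *[of x] *[of y] xy by (simp add: distrib_right)
  also have "\<dots> = (x + y) powr r" using xy by (cases "x + y = 0") (simp_all add: powr_mult_base)
  finally show ?thesis using xy
    by (simp add: enn_powr_ennreal ennreal_leI flip: ennreal_plus)
qed auto

lemma suminf_enn_powr_le:
  assumes r: "1 \<le> r" shows "(\<Sum>k. enn_powr (a k) r) \<le> enn_powr (\<Sum>k. a k) r"
proof -
  have "(\<Sum>k<m. enn_powr (a k) r) \<le> enn_powr (\<Sum>k<m. a k) r" for m
  proof (induction m)
    case (Suc m)
    have "(\<Sum>k<Suc m. enn_powr (a k) r) \<le> enn_powr (\<Sum>k<m. a k) r + enn_powr (a m) r"
      using Suc by (simp add: add_right_mono)
    also have "\<dots> \<le> enn_powr (\<Sum>k<Suc m. a k) r"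
      using enn_powr_superadditive[OF r] by simp
    finally show ?case .
  qed simp
  also have "enn_powr (\<Sum>k<m. a k) r \<le> enn_powr (\<Sum>k. a k) r" for m
    using r by (intro enn_powr_mono sum_le_suminf) auto
  finally show ?thesis unfolding suminf_eq_SUP by (rule SUP_least)
qed

text \<open>Jensen's inequality up to the factor \<open>2 powr r\<close>, valid for infinite integrals as well. If \<open>a\<close> is the
  integral of \<open>J\<close>, the part of \<open>J\<close> below the level \<open>a / (2 m)\<close> contributes at most half of \<open>a\<close>, and
  above that level \<open>J\<close> is dominated by a multiple of \<open>J powr r\<close>.\<close>

lemma jensen_enn_powr:
  fixes J :: "'a \<Rightarrow> ennreal" and r m :: real
  assumes r: "1 \<le> r" and m: "0 < m" and [measurable]: "J \<in> borel_measurable M" "Q \<in> sets M"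
    and Q: "emeasure M Q \<le> ennreal m" and supp: "\<And>x. x \<in> space M \<Longrightarrow> x \<notin> Q \<Longrightarrow> J x = 0"
  shows "enn_powr (\<integral>\<^sup>+x. J x \<partial>M) r \<le> ennreal (2 powr r * m powr (r - 1)) * (\<integral>\<^sup>+x. enn_powr (J x) r \<partial>M)"
proof (cases "(\<integral>\<^sup>+x. enn_powr (J x) r \<partial>M) = top")
  case True
  then show ?thesis using m by (simp add: ennreal_mult_top)
next
  case False
  then obtain R where R: "(\<integral>\<^sup>+x. enn_powr (J x) r \<partial>M) = ennreal R" "0 \<le> R"
    by (cases "\<integral>\<^sup>+x. enn_powr (J x) r \<partial>M") auto
  have split: "(\<integral>\<^sup>+x. J x \<partial>M) \<le> ennreal (\<delta> * m + \<delta> powr (1 - r) * R)" if \<delta>: "\<delta> > 0" for \<delta> :: real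
  proof -
    have "y \<le> ennreal \<delta> + ennreal (\<delta> powr (1 - r)) * enn_powr y r" for y
    proof (cases y)
      case (real u)
      have "u \<le> \<delta> + \<delta> powr (1 - r) * u powr r"
      proof (cases "u \<le> \<delta>")
        case False
        then have "u = u powr (1 - r) * u powr r" using \<delta> by (simp flip: powr_add)
        also have "\<dots> \<le> \<delta> powr (1 - r) * u powr r"
          using False \<delta> r by (intro mult_right_mono powr_mono2') auto
        finally show ?thesis using \<delta> by simp
      qed (simp add: add_increasing2)
      then show ?thesis using real \<delta>
        by (simp add: enn_powr_ennreal ennreal_leI flip: ennreal_mult ennreal_plus)
    qed (use \<delta> in \<open>simp add: ennreal_mult_top\<close>)
    then have "J x \<le> ennreal \<delta> * indicator Q x + ennreal (\<delta> powr (1 - r)) * enn_powr (J x) r"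
      if "x \<in> space M" for x
      using supp[OF that] by (auto simp: indicator_def)
    then have "(\<integral>\<^sup>+x. J x \<partial>M)
      \<le> (\<integral>\<^sup>+x. ennreal \<delta> * indicator Q x + ennreal (\<delta> powr (1 - r)) * enn_powr (J x) r \<partial>M)"
      by (intro nn_integral_mono)
    also have "\<dots> = ennreal \<delta> * emeasure M Q + ennreal (\<delta> powr (1 - r)) * ennreal R"
      by (simp add: nn_integral_add nn_integral_cmult R nn_integral_cmult_indicator)
    also have "\<dots> \<le> ennreal \<delta> * ennreal m + ennreal (\<delta> powr (1 - r)) * ennreal R"
      by (intro add_right_mono mult_left_mono Q) simp
    also have "\<dots> = ennreal (\<delta> * m + \<delta> powr (1 - r) * R)"
      using \<delta> m R by (simp add: ennreal_mult ennreal_plus)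
    finally show ?thesis .
  qed
  \<comment> \<open>finiteness of the integral, needed before half of it can be absorbed\<close>
  from split[of 1] have "(\<integral>\<^sup>+x. J x \<partial>M) < top"
    using le_less_trans ennreal_less_top by fastforce
  then obtain a where a: "(\<integral>\<^sup>+x. J x \<partial>M) = ennreal a" "0 \<le> a"
    by (cases "\<integral>\<^sup>+x. J x \<partial>M") auto
  show ?thesis
  proof (cases "a = 0")
    case False
    then have a0: "a > 0" using a by simp
    have "ennreal a \<le> ennreal (a / (2 * m) * m + (a / (2 * m)) powr (1 - r) * R)"
      using split[of "a / (2 * m)"] a a0 m by simp
    then have "a \<le> a / 2 + (a / (2 * m)) powr (1 - r) * R"
      using a0 m R by (subst (asm) ennreal_le_iff) auto
    then have "a / 2 \<le> (a / (2 * m)) powr (1 - r) * R" by simp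
    then have "a / 2 * (a / (2 * m)) powr (r - 1) \<le> (a / (2 * m)) powr (1 - r) * R * (a / (2 * m)) powr (r - 1)"
      by (rule mult_right_mono) simp
    also have "\<dots> = R * ((a / (2 * m)) powr (1 - r) * (a / (2 * m)) powr (r - 1))" by simp
    also have "(a / (2 * m)) powr (1 - r) * (a / (2 * m)) powr (r - 1) = 1"
      using a0 m by (simp flip: powr_add)
    also have "(a / (2 * m)) powr (r - 1) = (a / 2) powr (r - 1) / m powr (r - 1)"
      using a0 m by (simp add: powr_divide powr_mult)
    finally have "a / 2 * (a / 2) powr (r - 1) \<le> m powr (r - 1) * R"
      using m by (simp add: field_simps)
    moreover have "a / 2 * (a / 2) powr (r - 1) = a powr r / 2 powr r"
      using a0 by (simp add: powr_mult_base powr_divide)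
    ultimately have "a powr r / 2 powr r \<le> m powr (r - 1) * R" by metis
    then have "a powr r \<le> 2 powr r * m powr (r - 1) * R"
      by (simp add: pos_divide_le_eq mult_ac)
    then show ?thesis using a R
      by (simp add: enn_powr_ennreal ennreal_leI flip: ennreal_mult)
  qed (use a in simp)
qed

section \<open>Pointwise estimates by local integrals\<close>

lemma open_upper_halfspace: "open (upper_halfspace :: ((real^'n) \<times> real) set)"
proof -
  have "upper_halfspace = {z :: (real^'n) \<times> real. 0 < snd z}"
    by (auto simp: upper_halfspace_def)
  also have "open \<dots>" by (intro open_Collect_less continuous_intros)
  finally show ?thesis .
qed

definition TL_density :: "real \<Rightarrow> real \<Rightarrow> ((real^'n) \<times> real \<Rightarrow> real) \<Rightarrow> (real^'n) \<times> real \<Rightarrow> ennreal" where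
  "TL_density q \<alpha> f = (\<lambda>(x, t). ennreal (\<bar>f (x, t)\<bar> powr q * t powr (\<alpha> * q - 1)) * indicator {0<..} t)"

lemma TL_norm_eq:
  "TL_norm p q \<alpha> f = enn_powr (\<integral>\<^sup>+x. enn_powr (\<integral>\<^sup>+t. TL_density q \<alpha> f (x, t) \<partial>lborel) (p / q) \<partial>lborel) (1 / p)"
  unfolding TL_norm_def TL_density_def by simp

lemma TL_density_measurable:
  assumes f: "continuous_on upper_halfspace f" and q: "0 < q"
  shows "TL_density q \<alpha> f \<in> borel_measurable borel"
proof -
  have "continuous_on upper_halfspace (\<lambda>z. \<bar>f z\<bar> powr q * snd z powr (\<alpha> * q - 1))"
    by (intro continuous_on_mult continuous_on_abs_powr[OF f q] continuous_on_powr' continuous_intros)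
      (auto simp: upper_halfspace_def)
  then have [measurable]: "(\<lambda>z. indicator upper_halfspace z *\<^sub>R (\<bar>f z\<bar> powr q * snd z powr (\<alpha> * q - 1))) \<in> borel_measurable borel"
    by (intro borel_measurable_continuous_on_indicator borel_open open_upper_halfspace)
  have "TL_density q \<alpha> f = (\<lambda>z. ennreal (indicator upper_halfspace z *\<^sub>R (\<bar>f z\<bar> powr q * snd z powr (\<alpha> * q - 1))))"
    by (auto simp: TL_density_def upper_halfspace_def fun_eq_iff indicator_def)
  also have "\<dots> \<in> borel_measurable borel" by measurable
  finally show ?thesis .
qed

lemma nn_integral_lborel_pair:
  fixes F :: "'a::euclidean_space \<times> 'b::euclidean_space \<Rightarrow> ennreal"
  assumes "F \<in> borel_measurable borel"
  shows "(\<integral>\<^sup>+z. F z \<partial>lborel) = (\<integral>\<^sup>+x. \<integral>\<^sup>+y. F (x, y) \<partial>lborel \<partial>lborel)"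
  using assms lborel.nn_integral_fst[of F lborel] by (simp add: lborel_prod)

lemma measurable_lborel_section:
  fixes F :: "'a::euclidean_space \<times> 'b::euclidean_space \<Rightarrow> ennreal"
  assumes "F \<in> borel_measurable borel"
  shows "(\<lambda>x. \<integral>\<^sup>+y. F (x, y) \<partial>lborel) \<in> borel_measurable lborel"
  by (rule lborel.borel_measurable_nn_integral_fst) (use assms in \<open>simp add: lborel_prod\<close>)

text \<open>The local half of the embedding. The sub-mean value property bounds \<open>\<bar>f z\<bar> powr \<tau>\<close> by the average
  of \<open>\<bar>f\<bar> powr \<tau>\<close> over a ball of radius comparable to \<open>\<eta>\<close>. On \<open>E\<close> the height \<open>t\<close> is comparable to
  \<open>\<eta>\<close>, so the weight \<open>t powr (\<alpha> * \<tau> - 1)\<close> may be inserted at the price of a power of \<open>\<eta>\<close>. Since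
  \<open>p / \<tau> \<ge> 1\<close>, Jensen's inequality in the horizontal variable moves the exponent \<open>p / \<tau>\<close> inside the
  outer integral. The powers of \<open>\<eta>\<close> add up to the exponent of the Carleson condition.\<close>

lemma harmonic_powr_le_local_TL:
  fixes \<tau> p \<alpha> a b \<kappa> m :: real
  assumes \<tau>: "0 < \<tau>" and p: "\<tau> \<le> p" and pos: "0 < a" "0 < \<kappa>" "0 < m"
  obtains K where "0 < K"
    and "\<And>(f :: (real^'n) \<times> real \<Rightarrow> real) z \<eta> E Q. harmonic_on f upper_halfspace \<Longrightarrow> 0 < \<eta> \<Longrightarrow>
      E \<in> sets borel \<Longrightarrow> Q \<in> sets borel \<Longrightarrow> cball z (\<kappa> * \<eta>) \<subseteq> E \<Longrightarrow> E \<subseteq> upper_halfspace \<Longrightarrow>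
      E \<subseteq> Q \<times> {a * \<eta>..b * \<eta>} \<Longrightarrow>
      emeasure lborel Q \<le> ennreal (m * \<eta> ^ CARD('n)) \<Longrightarrow>
      ennreal (\<bar>f z\<bar> powr p) \<le> ennreal (K * \<eta> powr - (CARD('n) + \<alpha> * p)) *
        (\<integral>\<^sup>+x. enn_powr (\<integral>\<^sup>+t. indicator E (x, t) * TL_density \<tau> \<alpha> f (x, t) \<partial>lborel) (p / \<tau>) \<partial>lborel)"
proof -
  obtain K1 where K1: "K1 > 0" and submean:
    "\<And>(f :: (real^'n) \<times> real \<Rightarrow> real) S z r. harmonic_on f S \<Longrightarrow> open S \<Longrightarrow> r > 0 \<Longrightarrow>
      cball z r \<subseteq> S \<Longrightarrow> ennreal (r ^ DIM((real^'n) \<times> real) * \<bar>f z\<bar> powr \<tau>)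
        \<le> ennreal K1 * (\<integral>\<^sup>+w\<in>cball z r. ennreal (\<bar>f w\<bar> powr \<tau>) \<partial>lborel)"
    by (rule harmonic_powr_submean[OF \<tau>, where 'a = "(real^'n) \<times> real"]) (rule that)
  let ?n = "CARD('n)"
  define e where "e = 1 - \<alpha> * \<tau>"
  define r where "r = p / \<tau>"
  have r: "1 \<le> r" using \<tau> p by (simp add: r_def)
  define c where "c = a powr e + b powr e"
  have c: "0 < c" using pos by (simp add: c_def add_pos_nonneg)
  define C where "C = K1 * c / \<kappa> ^ (?n + 1)"
  have C: "0 < C" using K1 c pos by (simp add: C_def)
  define K where "K = C powr r * (2 powr r * m powr (r - 1))"
  show thesis
  proof (rule that)
    show "0 < K" using C pos by (simp add: K_def)
    fix f :: "(real^'n) \<times> real \<Rightarrow> real" and z :: "(real^'n) \<times> real" and \<eta> :: real and E Q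
    assume f: "harmonic_on f upper_halfspace" and \<eta>: "0 < \<eta>" and [measurable]: "E \<in> sets borel" "Q \<in> sets borel"
      and ball: "cball z (\<kappa> * \<eta>) \<subseteq> E" and EU: "E \<subseteq> upper_halfspace"
      and E: "E \<subseteq> Q \<times> {a * \<eta>..b * \<eta>}"
      and Q: "emeasure lborel Q \<le> ennreal (m * \<eta> ^ ?n)"
    have [measurable]: "TL_density \<tau> \<alpha> f \<in> borel_measurable borel"
      by (rule TL_density_measurable[OF harmonic_on_imp_continuous_on[OF f] \<tau>])
    let ?F = "\<lambda>w. indicator E w * TL_density \<tau> \<alpha> f w"
    have F: "?F \<in> borel_measurable borel" by measurable
    let ?J = "\<lambda>x. \<integral>\<^sup>+t. ?F (x, t) \<partial>lborel"
    have J: "?J \<in> borel_measurable lborel" by (rule measurable_lborel_section[OF F])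
    have pointwise: "ennreal (\<bar>f w\<bar> powr \<tau>) * indicator (cball z (\<kappa> * \<eta>)) w \<le> ennreal (c * \<eta> powr e) * ?F w" for w
    proof (cases "w \<in> cball z (\<kappa> * \<eta>)")
      case True
      obtain x t where w: "w = (x, t)" by (cases w)
      with True ball have wE: "(x, t) \<in> E" by auto
      then have t: "0 < t" "a * \<eta> \<le> t" "t \<le> b * \<eta>" using E EU by (auto simp: upper_halfspace_def)
      have b: "0 < b" using t \<eta> by (meson less_le_trans zero_less_mult_pos2)
      have "t powr e \<le> (a * \<eta>) powr e + (b * \<eta>) powr e"
        using t pos \<eta> by (intro powr_le_sum_endpoints) auto
      also have "\<dots> = c * \<eta> powr e" using pos \<eta> b by (simp add: c_def powr_mult distrib_right)
      finally have "\<bar>f w\<bar> powr \<tau> * t powr (\<alpha> * \<tau> - 1) * t powr e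
          \<le> \<bar>f w\<bar> powr \<tau> * t powr (\<alpha> * \<tau> - 1) * (c * \<eta> powr e)"
        by (rule mult_left_mono) simp
      moreover have "\<bar>f w\<bar> powr \<tau> * t powr (\<alpha> * \<tau> - 1) * t powr e = \<bar>f w\<bar> powr \<tau>"
        using t by (simp add: e_def mult.assoc flip: powr_add)
      ultimately have "\<bar>f w\<bar> powr \<tau> \<le> \<bar>f w\<bar> powr \<tau> * t powr (\<alpha> * \<tau> - 1) * (c * \<eta> powr e)"
        by metis
      then have "\<bar>f w\<bar> powr \<tau> \<le> (c * \<eta> powr e) * (\<bar>f w\<bar> powr \<tau> * t powr (\<alpha> * \<tau> - 1))"
        by (simp only: mult_ac)
      then show ?thesis using True wE t c
        by (simp add: w TL_density_def ennreal_leI flip: ennreal_mult)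
    qed simp
    have "ennreal ((\<kappa> * \<eta>) ^ (?n + 1) * \<bar>f z\<bar> powr \<tau>)
        \<le> ennreal K1 * (\<integral>\<^sup>+w\<in>cball z (\<kappa> * \<eta>). ennreal (\<bar>f w\<bar> powr \<tau>) \<partial>lborel)"
      using submean[OF f open_upper_halfspace, of "\<kappa> * \<eta>" z] ball EU pos \<eta> by simp
    also have "\<dots> \<le> ennreal K1 * (\<integral>\<^sup>+w. ennreal (c * \<eta> powr e) * ?F w \<partial>lborel)"
      by (intro mult_left_mono nn_integral_mono pointwise) simp
    also have "(\<integral>\<^sup>+w. ennreal (c * \<eta> powr e) * ?F w \<partial>lborel) = ennreal (c * \<eta> powr e) * (\<integral>\<^sup>+x. ?J x \<partial>lborel)"
      using F by (simp add: nn_integral_cmult nn_integral_lborel_pair)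
    finally have "ennreal (1 / (\<kappa> * \<eta>) ^ (?n + 1)) * ennreal ((\<kappa> * \<eta>) ^ (?n + 1) * \<bar>f z\<bar> powr \<tau>)
        \<le> ennreal (1 / (\<kappa> * \<eta>) ^ (?n + 1)) * (ennreal K1 * (ennreal (c * \<eta> powr e) * (\<integral>\<^sup>+x. ?J x \<partial>lborel)))"
      by (rule mult_left_mono) simp
    also have "ennreal (1 / (\<kappa> * \<eta>) ^ (?n + 1)) * ennreal ((\<kappa> * \<eta>) ^ (?n + 1) * \<bar>f z\<bar> powr \<tau>) = ennreal (\<bar>f z\<bar> powr \<tau>)"
      using pos \<eta> by (subst ennreal_mult[symmetric]) auto
    also have "ennreal (1 / (\<kappa> * \<eta>) ^ (?n + 1)) * (ennreal K1 * (ennreal (c * \<eta> powr e) * (\<integral>\<^sup>+x. ?J x \<partial>lborel)))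
        = ennreal (1 / (\<kappa> * \<eta>) ^ (?n + 1) * (K1 * (c * \<eta> powr e))) * (\<integral>\<^sup>+x. ?J x \<partial>lborel)"
    proof -
      have "ennreal u * (ennreal K1 * (ennreal v * I)) = ennreal (u * (K1 * v)) * I"
        if "0 \<le> u" "0 \<le> v" for u v I
        using that K1 by (simp add: ennreal_mult mult.assoc)
      then show ?thesis using pos \<eta> c by simp
    qed
    also have "1 / (\<kappa> * \<eta>) ^ (?n + 1) * (K1 * (c * \<eta> powr e)) = C * \<eta> powr (e - (?n + 1))"
      using \<eta> by (simp add: C_def powr_diff powr_realpow power_mult_distrib mult_ac flip: of_nat_Suc)
    finally have "enn_powr (ennreal (\<bar>f z\<bar> powr \<tau>)) r
        \<le> enn_powr (ennreal (C * \<eta> powr (e - (?n + 1))) * (\<integral>\<^sup>+x. ?J x \<partial>lborel)) r"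
      using r by (intro enn_powr_mono) auto
    also have "enn_powr (ennreal (\<bar>f z\<bar> powr \<tau>)) r = ennreal (\<bar>f z\<bar> powr p)"
      using \<tau> by (simp add: enn_powr_ennreal powr_powr r_def)
    also have "enn_powr (ennreal (C * \<eta> powr (e - (?n + 1))) * (\<integral>\<^sup>+x. ?J x \<partial>lborel)) r
        = ennreal ((C * \<eta> powr (e - (?n + 1))) powr r) * enn_powr (\<integral>\<^sup>+x. ?J x \<partial>lborel) r"
      using r C by (simp add: enn_powr_mult enn_powr_ennreal)
    also have "\<dots> \<le> ennreal ((C * \<eta> powr (e - (?n + 1))) powr r) *
        (ennreal (2 powr r * (m * \<eta> ^ ?n) powr (r - 1)) * (\<integral>\<^sup>+x. enn_powr (?J x) r \<partial>lborel))"
    proof (intro mult_left_mono jensen_enn_powr[OF r _ J _ Q])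
      fix x assume "x \<notin> Q"
      then have "?F (x, t) = 0" for t using E by (auto simp: indicator_def)
      then show "?J x = 0" by (simp only: nn_integral_0_iff_AE nn_integral_const mult_zero_left)
    qed (use pos \<eta> in auto)
    also have "\<dots> = ennreal ((C * \<eta> powr (e - (?n + 1))) powr r * (2 powr r * (m * \<eta> ^ ?n) powr (r - 1)))
        * (\<integral>\<^sup>+x. enn_powr (?J x) r \<partial>lborel)"
      by (simp add: ennreal_mult mult.assoc)
    also have "(C * \<eta> powr (e - (?n + 1))) powr r * (2 powr r * (m * \<eta> ^ ?n) powr (r - 1))
        = K * (\<eta> powr ((e - (?n + 1)) * r) * \<eta> powr (?n * (r - 1)))"
      using C pos \<eta> by (simp add: K_def powr_mult powr_powr flip: powr_realpow)
    also have "\<eta> powr ((e - (?n + 1)) * r) * \<eta> powr (?n * (r - 1)) = \<eta> powr - (?n + \<alpha> * p)"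
    proof -
      have "(e - (?n + 1)) * r + ?n * (r - 1) = - (?n + \<alpha> * (\<tau> * r))"
        by (simp add: e_def algebra_simps)
      also have "\<tau> * r = p" using \<tau> by (simp add: r_def)
      finally show ?thesis by (simp add: powr_add[symmetric] del: minus_add_distrib)
    qed
    finally show "ennreal (\<bar>f z\<bar> powr p) \<le> ennreal (K * \<eta> powr - (?n + \<alpha> * p)) *
        (\<integral>\<^sup>+x. enn_powr (?J x) (p / \<tau>) \<partial>lborel)"
      by (simp add: r_def)
  qed
qed

section \<open>Whitney cubes and the embedding\<close>

lemma mem_cube_prodD:
  fixes \<xi> :: "real^'n"
  assumes "(x, t) \<in> cube (\<xi>, \<eta>) l"
  shows "x \<in> cube \<xi> l" "\<bar>t - \<eta>\<bar> \<le> l / 2"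
proof -
  have *: "\<bar>((x, t) - (\<xi>, \<eta>)) \<bullet> b\<bar> \<le> l / 2" if "b \<in> Basis" for b
    using assms that by (simp add: mem_cube)
  show "x \<in> cube \<xi> l" unfolding mem_cube
  proof
    fix b :: "real^'n" assume "b \<in> Basis"
    then show "\<bar>(x - \<xi>) \<bullet> b\<bar> \<le> l / 2" using *[of "(b, 0)"] by (simp add: Basis_prod_def)
  qed
  show "\<bar>t - \<eta>\<bar> \<le> l / 2" using *[of "(0, 1)"] by (simp add: Basis_prod_def)
qed

lemma emeasure_cube: "0 \<le> l \<Longrightarrow> emeasure lborel (cube (z::'a::euclidean_space) l) = ennreal (l ^ DIM('a))"
  unfolding cube_def
  by (subst emeasure_lborel_cbox) (auto simp: inner_diff_left inner_add_left algebra_simps)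

text \<open>The comparability constants in the form used below. The lower bound on the side length comes from
  comparing the diameter with the distance to the boundary, which is at least \<open>\<eta> k - s k / 2\<close>; the
  upper bound holds because the bottom face of the cube lies in the half-space.\<close>

lemma whitney_geometry:
  fixes \<xi> :: "nat \<Rightarrow> real^'n"
  assumes "whitney_decomposition \<xi> \<eta> s"
  obtains a b \<kappa> :: real and N :: nat where "0 < a" "0 < \<kappa>"
    and "\<And>k. k \<ge> 1 \<Longrightarrow> 0 < \<eta> k \<and> 0 < s k \<and> s k \<le> 2 * \<eta> k \<and> 8 * \<kappa> * \<eta> k \<le> s k"
    and "\<And>k. k \<ge> 1 \<Longrightarrow> cube (\<xi> k, \<eta> k) (5 / 4 * s k) \<subseteq> upper_halfspace"
    and "\<And>k x t. k \<ge> 1 \<Longrightarrow> (x, t) \<in> cube (\<xi> k, \<eta> k) (5 / 4 * s k) \<Longrightarrow> a * \<eta> k \<le> t \<and> t \<le> b * \<eta> k"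
    and "\<And>z. z \<in> upper_halfspace \<Longrightarrow> finite {k. k \<ge> 1 \<and> z \<in> cube (\<xi> k, \<eta> k) (5 / 4 * s k)}
           \<and> card {k. k \<ge> 1 \<and> z \<in> cube (\<xi> k, \<eta> k) (5 / 4 * s k)} \<le> N"
    and "(\<Union>k\<in>{1..}. cube (\<xi> k, \<eta> k) (s k)) = upper_halfspace"
proof -
  let ?\<Delta> = "\<lambda>k. cube (\<xi> k, \<eta> k) (s k)" and ?\<Delta>' = "\<lambda>k. cube (\<xi> k, \<eta> k) (5 / 4 * s k)"
  let ?U = "upper_halfspace :: ((real^'n) \<times> real) set" and ?D = "DIM((real^'n) \<times> real)"
  note W = assms[unfolded whitney_decomposition_def Let_def]
  have s: "s k > 0" if "k \<ge> 1" for k using W[THEN conjunct1] that by blast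
  note W = W[THEN conjunct2, THEN conjunct2]
  have cover: "(\<Union>k\<in>{1..}. ?\<Delta> k) = ?U" by (rule W[THEN conjunct1])
  note W = W[THEN conjunct2]
  obtain c where c: "0 < c" "\<And>k. k \<ge> 1 \<Longrightarrow> c * setdist (?\<Delta> k) (frontier ?U) \<le> diameter (?\<Delta> k)"
    using W[THEN conjunct1] by blast
  note W = W[THEN conjunct2]
  have cover': "(\<Union>k\<in>{1..}. ?\<Delta>' k) = ?U" by (rule W[THEN conjunct1])
  note W = W[THEN conjunct2]
  obtain N where N: "\<And>z. z \<in> ?U \<Longrightarrow>
      finite {k. k \<ge> 1 \<and> z \<in> ?\<Delta>' k} \<and> card {k. k \<ge> 1 \<and> z \<in> ?\<Delta>' k} \<le> N"
    using W[THEN conjunct1] by blast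
  obtain a b where ab: "0 < a"
    "\<And>k x t. k \<ge> 1 \<Longrightarrow> (x, t) \<in> ?\<Delta>' k \<Longrightarrow> a * \<eta> k \<le> t \<and> t \<le> b * \<eta> k"
    using W[THEN conjunct2] by fast
  \<comment> \<open>obtained by solving \<open>c * (\<eta> k - s k / 2) \<le> s k * ?D\<close> for \<open>s k\<close>; the factor \<open>1 / 8\<close> leaves
      room for a ball inside the enlarged cube\<close>
  define \<kappa> where "\<kappa> = c / (?D + c / 2) / 8"
  have sub: "?\<Delta> k \<subseteq> ?U" if "k \<ge> 1" for k using cover that by auto
  have geo: "0 < \<eta> k \<and> 0 < s k \<and> s k \<le> 2 * \<eta> k \<and> 8 * \<kappa> * \<eta> k \<le> s k" if k: "k \<ge> 1" for k
  proof -
    have "(\<xi> k, \<eta> k - s k / 2) \<in> ?\<Delta> k"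
      using s[OF k] by (auto simp: mem_cube Basis_prod_def)
    with sub[OF k] have half: "s k < 2 * \<eta> k" by (auto simp: upper_halfspace_def)
    have centre: "(\<xi> k, \<eta> k) \<in> ?\<Delta> k"
      using s[OF k] by (simp add: mem_cube)
    have "frontier ?U \<noteq> {}"
    proof -
      have "(0, 1) \<in> ?U" "(0, 0) \<notin> ?U" by (auto simp: upper_halfspace_def)
      then show ?thesis by (metis UNIV_I empty_iff frontier_eq_empty)
    qed
    then have "\<eta> k - s k / 2 \<le> setdist (?\<Delta> k) (frontier ?U)"
    proof (rule le_setdistI[rotated])
      fix z y assume z: "z \<in> ?\<Delta> k" and y: "y \<in> frontier ?U"
      obtain x t where xt: "z = (x, t)" by (cases z)
      have "y \<notin> ?U" using y by (simp add: frontier_def interior_open open_upper_halfspace)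
      then have "snd y \<le> 0" by (auto simp: upper_halfspace_def case_prod_beta)
      moreover have "\<bar>t - \<eta> k\<bar> \<le> s k / 2" using z unfolding xt by (rule mem_cube_prodD)
      moreover have "\<bar>snd z - snd y\<bar> \<le> dist z y"
        using dist_snd_le[of z y] by (simp add: dist_real_def)
      ultimately show "\<eta> k - s k / 2 \<le> dist z y" unfolding xt snd_conv by arith
    qed (use centre in auto)
    then have "c * (\<eta> k - s k / 2) \<le> c * setdist (?\<Delta> k) (frontier ?U)"
      using c(1) by (intro mult_left_mono) auto
    also have "\<dots> \<le> diameter (?\<Delta> k)" by (rule c(2)[OF k])
    also have "\<dots> \<le> s k * ?D"
    proof (rule diameter_le)
      have "?\<Delta> k \<subseteq> cball (\<xi> k, \<eta> k) (s k / 2 * ?D)"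
        using cube_subset_cball[of "s k / 2" "s k / 2 * ?D" "(\<xi> k, \<eta> k)"] by simp
      then have rad: "dist (\<xi> k, \<eta> k) x \<le> s k / 2 * ?D" if "x \<in> ?\<Delta> k" for x
        using that by (meson mem_cball subsetD)
      show "norm (x - y) \<le> s k * ?D" if "x \<in> ?\<Delta> k" "y \<in> ?\<Delta> k" for x y
        using rad[OF that(1)] rad[OF that(2)] dist_triangle3[of x y "(\<xi> k, \<eta> k)"]
        unfolding dist_norm[symmetric] by linarith
    qed (use centre in auto)
    finally have "c * \<eta> k \<le> s k * (?D + c / 2)" by (simp add: algebra_simps)
    then have "8 * \<kappa> * \<eta> k \<le> s k" using c(1) by (simp add: \<kappa>_def field_simps)
    with half s[OF k] show ?thesis by auto
  qed
  show thesis
  proof (rule that[OF ab(1) _ geo _ ab(2) N cover])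
    show "0 < \<kappa>" using c(1) by (simp add: \<kappa>_def add_pos_pos)
    show "?\<Delta>' k \<subseteq> ?U" if "k \<ge> 1" for k using cover' that by auto
  qed
qed

text \<open>The factor \<open>5 / 4\<close> enlarges each half side by \<open>l / 8\<close>.\<close>

lemma cball_subset_enlarged_cube:
  assumes "z \<in> cube c l" "8 * r \<le> l"
  shows "cball z r \<subseteq> cube c (5 / 4 * l)"
proof
  fix w assume w: "w \<in> cball z r"
  show "w \<in> cube c (5 / 4 * l)" unfolding mem_cube
  proof
    fix b :: 'a assume b: "b \<in> Basis"
    have "\<bar>(w - z) \<bullet> b\<bar> \<le> r"
      using Basis_le_norm[OF b, of "w - z"] w by (simp add: dist_norm norm_minus_commute)
    moreover have "\<bar>(z - c) \<bullet> b\<bar> \<le> l / 2" using assms(1) b by (simp add: mem_cube)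
    ultimately show "\<bar>(w - c) \<bullet> b\<bar> \<le> 5 / 4 * l / 2"
      using assms(2) unfolding inner_diff_left by arith
  qed
qed

lemma suminf_indicator_le:
  assumes "finite {k::nat. w \<in> A k}" "card {k. w \<in> A k} \<le> N"
  shows "(\<Sum>k. indicator (A k) w :: ennreal) \<le> of_nat N"
proof -
  have "(\<Sum>k. indicator (A k) w :: ennreal) = (\<Sum>k\<in>{k. w \<in> A k}. indicator (A k) w)"
    by (rule suminf_finite[OF assms(1)]) (simp add: indicator_def)
  also have "\<dots> = of_nat (card {k. w \<in> A k})" by simp
  also have "\<dots> \<le> of_nat N" using assms(2) by simp
  finally show ?thesis .
qed

lemma borel_subset_upper_halfspace_in_sets:
  assumes "sets \<mu> = sets (restrict_space borel (upper_halfspace :: ((real^'n) \<times> real) set))"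
    and "A \<in> sets borel" "A \<subseteq> upper_halfspace"
  shows "A \<in> sets \<mu>"
  unfolding assms(1) using assms(2,3) borel_open[OF open_upper_halfspace]
  by (subst sets_restrict_space_iff) auto

lemma continuous_on_upper_halfspace_measurable:
  fixes f :: "(real^'n) \<times> real \<Rightarrow> real"
  assumes "sets \<mu> = sets (restrict_space borel (upper_halfspace :: ((real^'n) \<times> real) set))"
    and "continuous_on upper_halfspace f"
  shows "f \<in> borel_measurable \<mu>"
  by (subst measurable_cong_sets[OF assms(1) refl])
    (rule borel_measurable_continuous_on_restrict[OF assms(2)])

text \<open>On each Whitney cube \<open>\<bar>f\<bar> powr p\<close> is bounded by the local estimate, and the Carleson condition
  cancels the power of \<open>\<eta> k\<close> in it. What remains is to sum the local integrals. Because
  \<open>r = p / \<tau> \<ge> 1\<close>, a sum of \<open>r\<close>-th powers is at most the \<open>r\<close>-th power of the sum, and the sum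
  of the inner integrals is controlled by the finite overlap of the enlarged cubes.\<close>

lemma Lp_norm_le_TL_norm:
  fixes \<xi> :: "nat \<Rightarrow> real^'n" and \<eta> s :: "nat \<Rightarrow> real"
    and \<mu> :: "((real^'n) \<times> real) measure"
  assumes whitney: "whitney_decomposition \<xi> \<eta> s"
    and \<tau>: "0 < \<tau>" and p: "\<tau> \<le> p"
    and space: "space \<mu> = upper_halfspace"
    and sets: "sets \<mu> = sets (restrict_space borel upper_halfspace)"
    and C: "C \<ge> 0" and carleson: "\<And>k. k \<ge> 1 \<Longrightarrow> emeasure \<mu> (cube (\<xi> k, \<eta> k) (s k))
                     \<le> ennreal (C * \<eta> k powr (real CARD('n) + \<alpha> * p))"
  obtains B :: real where "B \<ge> 0"
    and "\<And>f. harmonic_on f upper_halfspace \<Longrightarrow> Lp_norm p \<mu> f \<le> ennreal B * TL_norm p \<tau> \<alpha> f"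
proof -
  let ?n = "CARD('n)" and ?U = "upper_halfspace :: ((real^'n) \<times> real) set"
  let ?\<Delta> = "\<lambda>k. cube (\<xi> k, \<eta> k) (s k)" and ?\<Delta>' = "\<lambda>k. cube (\<xi> k, \<eta> k) (5 / 4 * s k)"
  obtain a b \<kappa> N where a: "0 < a" and \<kappa>: "0 < \<kappa>"
    and geo: "\<And>k. k \<ge> 1 \<Longrightarrow> 0 < \<eta> k \<and> 0 < s k \<and> s k \<le> 2 * \<eta> k \<and> 8 * \<kappa> * \<eta> k \<le> s k"
    and sub: "\<And>k. k \<ge> 1 \<Longrightarrow> ?\<Delta>' k \<subseteq> ?U"
    and height: "\<And>k x t. k \<ge> 1 \<Longrightarrow> (x, t) \<in> ?\<Delta>' k \<Longrightarrow> a * \<eta> k \<le> t \<and> t \<le> b * \<eta> k"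
    and overlap: "\<And>z. z \<in> ?U \<Longrightarrow> finite {k. k \<ge> 1 \<and> z \<in> ?\<Delta>' k} \<and> card {k. k \<ge> 1 \<and> z \<in> ?\<Delta>' k} \<le> N"
    and cover: "(\<Union>k\<in>{1..}. ?\<Delta> k) = ?U"
    by (rule whitney_geometry[OF whitney]) (rule that)
  have m: "0 < (5 / 2 :: real) ^ ?n" by simp
  obtain K where K: "0 < K" and
    local: "\<And>(f :: (real^'n) \<times> real \<Rightarrow> real) z \<eta> E Q. harmonic_on f upper_halfspace \<Longrightarrow> 0 < \<eta> \<Longrightarrow>
      E \<in> sets borel \<Longrightarrow> Q \<in> sets borel \<Longrightarrow> cball z (\<kappa> * \<eta>) \<subseteq> E \<Longrightarrow> E \<subseteq> upper_halfspace \<Longrightarrow>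
      E \<subseteq> Q \<times> {a * \<eta>..b * \<eta>} \<Longrightarrow>
      emeasure lborel Q \<le> ennreal ((5 / 2) ^ ?n * \<eta> ^ CARD('n)) \<Longrightarrow>
      ennreal (\<bar>f z\<bar> powr p) \<le> ennreal (K * \<eta> powr - (CARD('n) + \<alpha> * p)) *
        (\<integral>\<^sup>+x. enn_powr (\<integral>\<^sup>+t. indicator E (x, t) * TL_density \<tau> \<alpha> f (x, t) \<partial>lborel) (p / \<tau>) \<partial>lborel)"
    by (rule harmonic_powr_le_local_TL[OF \<tau> p a \<kappa> m, where b=b and \<alpha>=\<alpha> and 'n='n]) (rule that)
  define r where "r = p / \<tau>"
  have r: "1 \<le> r" using \<tau> p by (simp add: r_def)
  have p0: "0 < p" using \<tau> p by simp
  define B where "B = (K * C * N powr r) powr (1 / p)"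
  show thesis
  proof (rule that)
    show "B \<ge> 0" by (simp add: B_def)
    fix f assume f: "harmonic_on f ?U"
    have cont: "continuous_on ?U f" by (rule harmonic_on_imp_continuous_on[OF f])
    let ?W = "TL_density \<tau> \<alpha> f"
    have [measurable]: "?W \<in> borel_measurable borel" by (rule TL_density_measurable[OF cont \<tau>])
    have [measurable]: "f \<in> borel_measurable \<mu>" by (rule continuous_on_upper_halfspace_measurable[OF sets cont])
    define J where "J = (\<lambda>k x. \<integral>\<^sup>+t. indicator (?\<Delta>' k) (x, t) * ?W (x, t) \<partial>lborel)"
    have [measurable]: "?\<Delta>' k \<in> sets borel" "?\<Delta> k \<in> sets borel" for k by (simp_all add: cube_def)
    have F: "(\<lambda>z. indicator (?\<Delta>' k) z * ?W z) \<in> borel_measurable borel" for k by measurable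
    have J[measurable]: "J k \<in> borel_measurable lborel" for k
      unfolding J_def by (rule measurable_lborel_section[OF F])
    have \<Delta>: "?\<Delta> k \<in> sets \<mu>" if "k \<ge> 1" for k
      using cover that by (intro borel_subset_upper_halfspace_in_sets[OF sets]) auto
    have one_cube: "(\<integral>\<^sup>+z. ennreal (\<bar>f z\<bar> powr p) * indicator (?\<Delta> k) z \<partial>\<mu>)
        \<le> ennreal (K * C) * (\<integral>\<^sup>+x. enn_powr (J k x) r \<partial>lborel)" if k: "k \<ge> 1" for k
    proof -
      let ?e = "real ?n + \<alpha> * p"
      let ?A = "ennreal (K * \<eta> k powr - ?e) * (\<integral>\<^sup>+x. enn_powr (J k x) r \<partial>lborel)"
      have "ennreal (\<bar>f z\<bar> powr p) \<le> ?A" if z: "z \<in> ?\<Delta> k" for z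
        unfolding J_def r_def
      proof (rule local[OF f])
        show "cball z (\<kappa> * \<eta> k) \<subseteq> ?\<Delta>' k"
          using geo[OF k] by (intro cball_subset_enlarged_cube[OF z]) auto
        show "?\<Delta>' k \<subseteq> cube (\<xi> k) (5 / 4 * s k) \<times> {a * \<eta> k..b * \<eta> k}"
          using height[OF k] mem_cube_prodD(1) by auto
        have "emeasure lborel (cube (\<xi> k) (5 / 4 * s k)) = ennreal ((5 / 4 * s k) ^ ?n)"
          using geo[OF k] by (simp add: emeasure_cube)
        also have "\<dots> \<le> ennreal ((5 / 2 * \<eta> k) ^ ?n)"
          using geo[OF k] by (intro ennreal_leI power_mono) auto
        finally show "emeasure lborel (cube (\<xi> k) (5 / 4 * s k)) \<le> ennreal ((5 / 2) ^ ?n * \<eta> k ^ ?n)"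
          by (simp only: power_mult_distrib)
      qed (use geo[OF k] sub[OF k] in \<open>auto simp: cube_def\<close>)
      then have "(\<integral>\<^sup>+z. ennreal (\<bar>f z\<bar> powr p) * indicator (?\<Delta> k) z \<partial>\<mu>)
          \<le> (\<integral>\<^sup>+z. ?A * indicator (?\<Delta> k) z \<partial>\<mu>)"
        by (intro nn_integral_mono) (auto simp: indicator_def)
      also have "\<dots> = ?A * emeasure \<mu> (?\<Delta> k)" by (rule nn_integral_cmult_indicator[OF \<Delta>[OF k]])
      also have "\<dots> \<le> ?A * ennreal (C * \<eta> k powr ?e)" by (intro mult_left_mono carleson[OF k]) simp
      also have "\<dots> = (ennreal (K * \<eta> k powr - ?e) * ennreal (C * \<eta> k powr ?e)) * (\<integral>\<^sup>+x. enn_powr (J k x) r \<partial>lborel)"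
        by (simp only: mult_ac)
      also have "ennreal (K * \<eta> k powr - ?e) * ennreal (C * \<eta> k powr ?e) = ennreal (K * C * (\<eta> k powr - ?e * \<eta> k powr ?e))"
        using K C by (subst ennreal_mult[symmetric]) (auto simp only: mult_ac zero_le_mult_iff powr_ge_zero less_imp_le)
      also have "\<eta> k powr - ?e * \<eta> k powr ?e = 1" using geo[OF k] by (subst powr_add[symmetric]) simp
      finally show ?thesis by simp
    qed
    \<comment> \<open>the cubes are numbered from 1, the series from 0\<close>
    have sumJ: "(\<Sum>k. J (Suc k) x) \<le> of_nat N * (\<integral>\<^sup>+t. ?W (x, t) \<partial>lborel)" for x
    proof -
      have meas: "(\<lambda>t. indicator (?\<Delta>' k) (x, t) * ?W (x, t)) \<in> borel_measurable lborel" for k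
        by measurable
      have pt: "(\<Sum>k. indicator (?\<Delta>' (Suc k)) (x, t) * ?W (x, t)) \<le> of_nat N * ?W (x, t)" for t
      proof (cases "(x, t) \<in> ?U")
        case True
        have eq: "{k. k \<ge> 1 \<and> (x, t) \<in> ?\<Delta>' k} = Suc ` {k. (x, t) \<in> ?\<Delta>' (Suc k)}"
          by (auto simp: image_iff) (metis Suc_le_D)
        have "(\<Sum>k. indicator (?\<Delta>' (Suc k)) (x, t) :: ennreal) \<le> of_nat N"
          using overlap[OF True] unfolding eq
          by (intro suminf_indicator_le) (auto simp: card_image finite_image_iff)
        then show ?thesis by (simp add: ennreal_suminf_multc mult_right_mono)
      qed (simp add: TL_density_def upper_halfspace_def)
      have "(\<Sum>k. J (Suc k) x) = (\<integral>\<^sup>+t. (\<Sum>k. indicator (?\<Delta>' (Suc k)) (x, t) * ?W (x, t)) \<partial>lborel)"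
        unfolding J_def by (rule nn_integral_suminf[symmetric, OF meas])
      also have "\<dots> \<le> (\<integral>\<^sup>+t. of_nat N * ?W (x, t) \<partial>lborel)" by (intro nn_integral_mono pt)
      also have "\<dots> = of_nat N * (\<integral>\<^sup>+t. ?W (x, t) \<partial>lborel)" by (intro nn_integral_cmult) measurable
      finally show ?thesis .
    qed
    have "(\<integral>\<^sup>+z. ennreal (\<bar>f z\<bar> powr p) \<partial>\<mu>)
        \<le> (\<integral>\<^sup>+z. (\<Sum>k. ennreal (\<bar>f z\<bar> powr p) * indicator (?\<Delta> (Suc k)) z) \<partial>\<mu>)"
    proof (rule nn_integral_mono)
      fix z assume "z \<in> space \<mu>"
      then obtain k where "k \<ge> 1" "z \<in> ?\<Delta> k" using cover space by auto
      then obtain j where j: "z \<in> ?\<Delta> (Suc j)" by (cases k) auto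
      have "ennreal (\<bar>f z\<bar> powr p) = (\<Sum>k\<in>{j}. ennreal (\<bar>f z\<bar> powr p) * indicator (?\<Delta> (Suc k)) z)"
        using j by simp
      also have "\<dots> \<le> (\<Sum>k. ennreal (\<bar>f z\<bar> powr p) * indicator (?\<Delta> (Suc k)) z)"
        by (intro sum_le_suminf) auto
      finally show "ennreal (\<bar>f z\<bar> powr p) \<le> (\<Sum>k. ennreal (\<bar>f z\<bar> powr p) * indicator (?\<Delta> (Suc k)) z)" .
    qed
    also have "\<dots> = (\<Sum>k. \<integral>\<^sup>+z. ennreal (\<bar>f z\<bar> powr p) * indicator (?\<Delta> (Suc k)) z \<partial>\<mu>)"
    proof (rule nn_integral_suminf)
      fix k
      have [measurable]: "?\<Delta> (Suc k) \<in> sets \<mu>" by (rule \<Delta>) simp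
      show "(\<lambda>z. ennreal (\<bar>f z\<bar> powr p) * indicator (?\<Delta> (Suc k)) z) \<in> borel_measurable \<mu>"
        by measurable
    qed
    also have "\<dots> \<le> (\<Sum>k. ennreal (K * C) * (\<integral>\<^sup>+x. enn_powr (J (Suc k) x) r \<partial>lborel))"
      by (intro suminf_le one_cube) auto
    also have "\<dots> = ennreal (K * C) * (\<integral>\<^sup>+x. (\<Sum>k. enn_powr (J (Suc k) x) r) \<partial>lborel)"
      by (subst nn_integral_suminf) (auto simp: ennreal_suminf_cmult)
    also have "\<dots> \<le> ennreal (K * C) * (\<integral>\<^sup>+x. enn_powr (of_nat N) r * enn_powr (\<integral>\<^sup>+t. ?W (x, t) \<partial>lborel) r \<partial>lborel)"
    proof (intro mult_left_mono nn_integral_mono)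
      fix x
      have "(\<Sum>k. enn_powr (J (Suc k) x) r) \<le> enn_powr (\<Sum>k. J (Suc k) x) r"
        by (rule suminf_enn_powr_le[OF r])
      also have "\<dots> \<le> enn_powr (of_nat N * (\<integral>\<^sup>+t. ?W (x, t) \<partial>lborel)) r"
        using r by (intro enn_powr_mono sumJ) auto
      also have "\<dots> = enn_powr (of_nat N) r * enn_powr (\<integral>\<^sup>+t. ?W (x, t) \<partial>lborel) r"
        using r by (intro enn_powr_mult) auto
      finally show "(\<Sum>k. enn_powr (J (Suc k) x) r) \<le> enn_powr (of_nat N) r * enn_powr (\<integral>\<^sup>+t. ?W (x, t) \<partial>lborel) r" .
    qed simp
    also have "\<dots> = ennreal (K * C) * enn_powr (of_nat N) r * (\<integral>\<^sup>+x. enn_powr (\<integral>\<^sup>+t. ?W (x, t) \<partial>lborel) r \<partial>lborel)"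
      by (subst nn_integral_cmult) (auto intro!: measurable_enn_powr measurable_lborel_section simp: mult.assoc)
    also have "ennreal (K * C) * enn_powr (of_nat N) r = ennreal (K * C * N powr r)"
      using K C by (simp add: enn_powr_ennreal ennreal_mult ennreal_of_nat_eq_real_of_nat)
    finally have "enn_powr (\<integral>\<^sup>+z. ennreal (\<bar>f z\<bar> powr p) \<partial>\<mu>) (1 / p)
        \<le> enn_powr (ennreal (K * C * N powr r) * (\<integral>\<^sup>+x. enn_powr (\<integral>\<^sup>+t. ?W (x, t) \<partial>lborel) r \<partial>lborel)) (1 / p)"
      using p0 by (intro enn_powr_mono) auto
    then show "Lp_norm p \<mu> f \<le> ennreal B * TL_norm p \<tau> \<alpha> f"
      using p0 K C by (simp add: Lp_norm_def TL_norm_eq B_def r_def enn_powr_mult enn_powr_ennreal)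
  qed
qed

section \<open>Harmonic functions of rapid decay\<close>

text \<open>Representing the first derivative by a gradient field avoids handling the operator-valued second
  derivative in concrete computations.\<close>

lemma harmonic_onI_gradient:
  fixes f :: "'a::euclidean_space \<Rightarrow> real"
  assumes f: "\<And>z. z \<in> S \<Longrightarrow> (f has_derivative (\<lambda>h. G z \<bullet> h)) (at z)"
    and G: "\<And>z. z \<in> S \<Longrightarrow> (G has_derivative G' z) (at z)"
    and cont: "\<And>b. b \<in> Basis \<Longrightarrow> continuous_on S (\<lambda>z. G' z b)"
    and trace: "\<And>z. z \<in> S \<Longrightarrow> (\<Sum>b\<in>Basis. G' z b \<bullet> b) = 0"
  shows "harmonic_on f S"
proof -
  define D where "D = (\<lambda>z. blinfun_inner_right (G z))"
  define H where "H = (\<lambda>z. Blinfun (\<lambda>k. blinfun_inner_right (G' z k)))"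
  have H: "blinfun_apply (H z) = (\<lambda>k. blinfun_inner_right (G' z k))" if "z \<in> S" for z
    unfolding H_def
    by (rule bounded_linear_Blinfun_apply, rule bounded_linear_compose[OF bounded_linear_blinfun_inner_right])
      (use G[OF that] in \<open>rule has_derivative_bounded_linear\<close>)
  show ?thesis unfolding harmonic_on_def
  proof (intro exI[of _ D] exI[of _ H] conjI ballI)
    show "(f has_derivative D z) (at z)" if "z \<in> S" for z
      using f[OF that] by (simp add: D_def)
    show "(D has_derivative H z) (at z)" if "z \<in> S" for z
      unfolding H[OF that] D_def
      by (rule bounded_linear.has_derivative[OF bounded_linear_blinfun_inner_right G[OF that]])
    show "continuous_on S H"
    proof (rule continuous_on_blinfun_componentwise)
      fix b :: 'a assume "b \<in> Basis"
      then have "continuous_on S (\<lambda>z. blinfun_inner_right (G' z b))"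
        by (intro bounded_linear.continuous_on[OF bounded_linear_blinfun_inner_right] cont)
      then show "continuous_on S (\<lambda>z. H z b)"
        by (rule continuous_on_eq) (simp add: H)
    qed
    show "(\<Sum>b\<in>Basis. H z b b) = 0" if "z \<in> S" for z
      using trace[OF that] by (simp add: H[OF that])
  qed
qed

lemma harmonic_on_affine:
  fixes f :: "'a::euclidean_space \<Rightarrow> real"
  assumes f: "harmonic_on f S" and T: "\<And>z. z \<in> T \<Longrightarrow> c *\<^sub>R (z - z0) + w \<in> S"
  shows "harmonic_on (\<lambda>z. f (c *\<^sub>R (z - z0) + w)) T"
proof -
  let ?A = "\<lambda>z. c *\<^sub>R (z - z0) + w"
  from f obtain D :: "'a \<Rightarrow> 'a \<Rightarrow>\<^sub>L real" and H :: "'a \<Rightarrow> 'a \<Rightarrow>\<^sub>L ('a \<Rightarrow>\<^sub>L real)" where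
    D: "\<And>w. w \<in> S \<Longrightarrow> (f has_derivative blinfun_apply (D w)) (at w)" and
    H: "\<And>w. w \<in> S \<Longrightarrow> (D has_derivative blinfun_apply (H w)) (at w)" and
    cont: "continuous_on S H" and trace: "\<And>w. w \<in> S \<Longrightarrow> (\<Sum>b\<in>Basis. H w b b) = 0"
    unfolding harmonic_on_def by blast
  have A: "(?A has_derivative (\<lambda>h. c *\<^sub>R h)) (at z)" for z
    by (auto intro!: derivative_eq_intros)
  show ?thesis unfolding harmonic_on_def
  proof (intro exI[of _ "\<lambda>z. c *\<^sub>R D (?A z)"] exI[of _ "\<lambda>z. (c * c) *\<^sub>R H (?A z)"] conjI ballI)
    fix z assume z: "z \<in> T"
    show "((\<lambda>z. f (?A z)) has_derivative (c *\<^sub>R D (?A z))) (at z)"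
      by (rule has_derivative_eq_rhs[OF has_derivative_compose[OF A D[OF T[OF z]]]])
        (simp add: fun_eq_iff blinfun.bilinear_simps)
    have "((\<lambda>z. D (?A z)) has_derivative (\<lambda>h. H (?A z) (c *\<^sub>R h))) (at z)"
      by (rule has_derivative_compose[OF A H[OF T[OF z]]])
    then show "((\<lambda>z. c *\<^sub>R D (?A z)) has_derivative ((c * c) *\<^sub>R H (?A z))) (at z)"
      by (rule has_derivative_eq_rhs[OF has_derivative_scaleR_right])
        (simp add: fun_eq_iff blinfun.bilinear_simps)
    show "(\<Sum>b\<in>Basis. ((c * c) *\<^sub>R H (?A z)) b b) = 0"
      using trace[OF T[OF z]] by (simp add: blinfun.bilinear_simps flip: sum_distrib_left)
  next
    show "continuous_on T (\<lambda>z. (c * c) *\<^sub>R H (?A z))"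
      by (intro continuous_intros continuous_on_compose2[OF cont]) (use T in auto)
  qed
qed

text \<open>For orthonormal \<open>e1\<close> and \<open>e2\<close>, the orthogonal projection to their plane, read as a complex
  number.\<close>

definition plane_coord :: "'a \<Rightarrow> 'a \<Rightarrow> 'a::euclidean_space \<Rightarrow> complex" where
  "plane_coord e1 e2 z = Complex (z \<bullet> e1) (z \<bullet> e2)"

text \<open>For orthonormal \<open>e1\<close> and \<open>e2\<close>, the Kelvin transform of the homogeneous harmonic polynomial
  \<open>Re ((z \<bullet> e1 + \<i> (z \<bullet> e2)) ^ m)\<close>. It is a homogeneous function of degree \<open>- (DIM('a) - 2 + m)\<close>, so that its decay at infinity can be made
  as fast as desired.\<close>

definition kelvin_power :: "nat \<Rightarrow> 'a \<Rightarrow> 'a \<Rightarrow> 'a::euclidean_space \<Rightarrow> real" where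
  "kelvin_power m e1 e2 z =
     Re (plane_coord e1 e2 z ^ m) * (z \<bullet> z) powr - (real DIM('a) / 2 - 1 + real m)"

text \<open>Write \<open>P\<close> for the polynomial and \<open>R = z \<bullet> z\<close>. The Laplacian of \<open>P * R powr - s\<close> has three
  contributions. The Laplacian of \<open>P\<close> vanishes since \<open>1\<^sup>2 + \<i>\<^sup>2 = 0\<close>; the mixed term is
  \<open>- 4 s m P R powr (- s - 1)\<close> by Euler's identity for homogeneous functions; and the Laplacian of
  \<open>R powr - s\<close> contributes \<open>(4 s (s + 1) - 2 s DIM('a)) P R powr (- s - 1)\<close>. They cancel exactly for
  the exponent \<open>s\<close> in the definition.\<close>

lemma harmonic_kelvin_power:
  fixes e1 e2 :: "'a::euclidean_space"
  assumes e: "e1 \<in> Basis" "e2 \<in> Basis" "e1 \<noteq> e2" and m: "m \<ge> 2"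
  shows "harmonic_on (kelvin_power m e1 e2) (- {0})"
proof -
  let ?l = "plane_coord e1 e2"
  define s where "s = real DIM('a) / 2 - 1 + real m"
  let ?P = "\<lambda>z. Re (?l z ^ m)"
  let ?\<phi> = "\<lambda>z::'a. (z \<bullet> z) powr - s" and ?\<chi> = "\<lambda>z::'a. (z \<bullet> z) powr (- s - 1)"
  let ?\<omega> = "\<lambda>z::'a. (z \<bullet> z) powr (- s - 2)"
  define A where "A = (\<lambda>c. Re c *\<^sub>R e1 - Im c *\<^sub>R e2)"
  have A: "bounded_linear A"
    unfolding A_def by (intro bounded_linear_intros bounded_linear_Re bounded_linear_Im)
  have A_inner: "A c \<bullet> h = Re (c * ?l h)" for c h
    by (simp add: A_def plane_coord_def inner_diff_left inner_commute[of h])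
  have l: "bounded_linear ?l"
  proof -
    have "?l = (\<lambda>z. (z \<bullet> e1) *\<^sub>R 1 + (z \<bullet> e2) *\<^sub>R \<i>)"
      by (auto simp: plane_coord_def complex_eq_iff)
    then show ?thesis by (simp only:) (intro bounded_linear_intros)
  qed
  have lder: "(?l has_derivative ?l) (at z)" for z
    by (rule bounded_linear_imp_has_derivative[OF l])
  have lcont: "continuous_on S ?l" for S by (rule linear_continuous_on[OF l])
  define L1 where "L1 = (\<lambda>z. of_nat m * ?l z ^ (m - 1))"
  define L2 where "L2 = (\<lambda>z k. of_nat m * (of_nat (m - 1) * ?l k * ?l z ^ (m - 2)))"
  have m1: "m - 1 - 1 = m - 2" by simp
  have dP: "(?P has_derivative (\<lambda>h. A (L1 z) \<bullet> h)) (at z)" for z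
    by (rule has_derivative_eq_rhs[OF bounded_linear.has_derivative[OF bounded_linear_Re has_derivative_power[OF lder]]])
      (simp add: A_inner L1_def fun_eq_iff mult_ac)
  have dL1: "(L1 has_derivative L2 z) (at z)" for z
    unfolding L1_def L2_def
    by (rule has_derivative_eq_rhs[OF has_derivative_mult_right[OF has_derivative_power[OF lder]]])
      (simp only: m1)
  have dpow: "((\<lambda>z::'a. (z \<bullet> z) powr a) has_derivative (\<lambda>h. 2 * a * (z \<bullet> z) powr (a - 1) * (z \<bullet> h))) (at z)"
    if "z \<noteq> 0" for z :: 'a and a
  proof -
    have "((\<lambda>x. x powr a) has_real_derivative a * (z \<bullet> z) powr (a - 1)) (at (z \<bullet> z))"
      by (rule has_real_derivative_powr) (use that in simp)
    moreover have "((\<lambda>z. z \<bullet> z) has_derivative (\<lambda>h. z \<bullet> h + h \<bullet> z)) (at z)"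
      by (auto intro!: derivative_eq_intros)
    ultimately have "((\<lambda>z. (z \<bullet> z) powr a) has_derivative (\<lambda>h. a * (z \<bullet> z) powr (a - 1) * (z \<bullet> h + h \<bullet> z))) (at z)"
      unfolding has_field_derivative_def
      by (rule has_derivative_compose[where f = "\<lambda>z. z \<bullet> z" and g = "\<lambda>x. x powr a", rotated])
    then show ?thesis by (rule has_derivative_eq_rhs) (simp add: fun_eq_iff inner_commute algebra_simps)
  qed
  define G where "G = (\<lambda>z. ?\<phi> z *\<^sub>R A (L1 z) - (2 * s * (?P z * ?\<chi> z)) *\<^sub>R z)"
  define G' where "G' = (\<lambda>z k. ?\<phi> z *\<^sub>R A (L2 z k) + (2 * - s * ?\<chi> z * (z \<bullet> k)) *\<^sub>R A (L1 z)
     - ((2 * s * (?P z * ?\<chi> z)) *\<^sub>R k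
        + (2 * s * (?P z * (2 * (- s - 1) * ?\<omega> z * (z \<bullet> k)) + (A (L1 z) \<bullet> k) * ?\<chi> z)) *\<^sub>R z))"
  show ?thesis
  proof (rule harmonic_onI_gradient)
    fix z :: 'a assume "z \<in> - {0}"
    then have z: "z \<noteq> 0" by simp
    have "(kelvin_power m e1 e2 has_derivative
        (\<lambda>h. ?P z * (2 * - s * (z \<bullet> z) powr (- s - 1) * (z \<bullet> h)) + (A (L1 z) \<bullet> h) * ?\<phi> z)) (at z)"
      unfolding kelvin_power_def s_def[symmetric]
      by (rule has_derivative_mult[OF dP dpow[OF z]])
    then show "(kelvin_power m e1 e2 has_derivative (\<lambda>h. G z \<bullet> h)) (at z)"
      by (rule has_derivative_eq_rhs) (simp add: fun_eq_iff G_def inner_diff_left algebra_simps)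
    have d\<chi>: "(?\<chi> has_derivative (\<lambda>k. 2 * (- s - 1) * ?\<omega> z * (z \<bullet> k))) (at z)"
      using dpow[OF z, of "- s - 1"] by (simp add: diff_diff_eq)
    show "(G has_derivative G' z) (at z)"
      unfolding G_def G'_def
      by (intro has_derivative_diff has_derivative_scaleR has_derivative_mult_right
          has_derivative_mult dP d\<chi> dpow[OF z] bounded_linear.has_derivative[OF A dL1] has_derivative_ident)
    have "(\<Sum>b\<in>Basis. G' z b \<bullet> b) = ?\<phi> z * (\<Sum>b\<in>Basis. A (L2 z b) \<bullet> b)
        - 2 * s * ?\<chi> z * (\<Sum>b\<in>Basis. (z \<bullet> b) * (A (L1 z) \<bullet> b))
        - 2 * s * ?P z * ?\<chi> z * (\<Sum>b\<in>(Basis::'a set). b \<bullet> b)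
        + 4 * s * (s + 1) * ?P z * ?\<omega> z * (\<Sum>b\<in>Basis. (z \<bullet> b) * (z \<bullet> b))
        - 2 * s * ?\<chi> z * (\<Sum>b\<in>Basis. (z \<bullet> b) * (A (L1 z) \<bullet> b))"
      unfolding G'_def
      by (simp add: inner_diff_left inner_add_left sum.distrib sum_subtractf sum_distrib_left
          sum_distrib_right sum_negf algebra_simps)
    also have "(\<Sum>b\<in>Basis. A (L2 z b) \<bullet> b) = 0"
    proof -
      have "(\<Sum>b\<in>Basis. ?l b * ?l b) = (\<Sum>b\<in>{e1, e2}. ?l b * ?l b)"
        using e by (intro sum.mono_neutral_right) (auto simp: plane_coord_def inner_Basis complex_eq_iff)
      also have "\<dots> = 0" using e by (simp add: plane_coord_def inner_Basis complex_eq_iff)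
      finally have 0: "(\<Sum>b\<in>Basis. ?l b * ?l b) = 0" .
      have "(\<Sum>b\<in>Basis. A (L2 z b) \<bullet> b) = Re (of_nat m * of_nat (m - 1) * ?l z ^ (m - 2) * (\<Sum>b\<in>Basis. ?l b * ?l b))"
        by (simp only: A_inner L2_def sum_distrib_left Re_sum mult_ac)
      then show ?thesis by (simp add: 0)
    qed
    \<comment> \<open>Euler's identity for the polynomial of degree \<open>m\<close>\<close>
    also have "(\<Sum>b\<in>Basis. (z \<bullet> b) * (A (L1 z) \<bullet> b)) = m * ?P z"
    proof -
      have "(\<Sum>b\<in>Basis. (z \<bullet> b) * (A (L1 z) \<bullet> b)) = A (L1 z) \<bullet> z"
        by (subst (2) euclidean_inner) (simp add: mult_ac)
      also have "\<dots> = Re (of_nat m * (?l z ^ (m - 1) * ?l z))" by (simp add: A_inner L1_def mult_ac)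
      also have "?l z ^ (m - 1) * ?l z = ?l z ^ m" using m by (simp flip: power_Suc2)
      finally show ?thesis by simp
    qed
    also have "(\<Sum>b\<in>(Basis::'a set). b \<bullet> b) = DIM('a)" by (simp add: inner_Basis)
    also have "(\<Sum>b\<in>Basis. (z \<bullet> b) * (z \<bullet> b)) = z \<bullet> z" by (rule euclidean_inner[symmetric])
    also have "?\<chi> z = ?\<omega> z * (z \<bullet> z)"
    proof -
      have "- s - 1 = 1 + (- s - 2)" by simp
      then show ?thesis using powr_mult_base[of "z \<bullet> z" "- s - 2"] by (metis inner_ge_zero mult.commute)
    qed
    finally show "(\<Sum>b\<in>Basis. G' z b \<bullet> b) = 0"
      by (simp add: s_def field_simps)
  next
    fix b :: 'a
    have Ac: "continuous_on S (\<lambda>z. A (g z))" if "continuous_on S g" for S g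
      by (rule bounded_linear.continuous_on[OF A that])
    show "continuous_on (- {0}) (\<lambda>z. G' z b)"
      unfolding G'_def L1_def L2_def by (intro continuous_intros Ac lcont) auto
  qed
qed

lemma kelvin_power_decay:
  fixes e1 e2 :: "'a::euclidean_space"
  assumes e: "e1 \<in> Basis" "e2 \<in> Basis" "e1 \<noteq> e2" and z: "1 \<le> norm z" and dim: "2 \<le> DIM('a)"
  shows "\<bar>kelvin_power m e1 e2 z\<bar> \<le> 1 / norm z ^ m"
proof -
  have "(cmod (plane_coord e1 e2 z))\<^sup>2 = (\<Sum>b\<in>{e1, e2}. (z \<bullet> b) * (z \<bullet> b))"
    using e by (simp add: plane_coord_def cmod_def power2_eq_square)
  also have "\<dots> \<le> (\<Sum>b\<in>Basis. (z \<bullet> b) * (z \<bullet> b))"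
    using e by (intro sum_mono2) auto
  also have "\<dots> = (norm z)\<^sup>2" by (simp add: euclidean_inner[symmetric] power2_norm_eq_inner)
  finally have l: "cmod (plane_coord e1 e2 z) \<le> norm z" by (rule power2_le_imp_le) simp
  have "\<bar>Re (plane_coord e1 e2 z ^ m)\<bar> \<le> cmod (plane_coord e1 e2 z ^ m)" by (rule abs_Re_le_cmod)
  also have "\<dots> \<le> norm z ^ m" unfolding norm_power by (rule power_mono[OF l]) simp
  finally have P: "\<bar>Re (plane_coord e1 e2 z ^ m)\<bar> \<le> norm z ^ m" .
  have "(z \<bullet> z) powr - (real DIM('a) / 2 - 1 + real m) \<le> (z \<bullet> z) powr - real m"
    using dim z by (intro powr_mono) (auto simp: dot_square_norm)
  also have "\<dots> = 1 / (norm z ^ m * norm z ^ m)"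
    using z powr_realpow[of "norm z" m, OF less_le_trans[OF zero_less_one z]]
    by (simp add: powr_minus powr_mult dot_square_norm power2_eq_square divide_inverse)
  finally have "\<bar>kelvin_power m e1 e2 z\<bar> \<le> norm z ^ m * (1 / (norm z ^ m * norm z ^ m))"
    unfolding kelvin_power_def abs_mult by (intro mult_mono P) auto
  also have "\<dots> = 1 / norm z ^ m" using z by auto
  finally show ?thesis .
qed

section \<open>Norms of rescaled functions\<close>

lemma nn_integral_scale_real:
  assumes [measurable]: "g \<in> borel_measurable borel" and c: "0 < (c::real)"
  shows "(\<integral>\<^sup>+x. g ((x - a) / c) \<partial>lborel) = ennreal c * (\<integral>\<^sup>+y. g y \<partial>lborel)"
proof -
  have "(\<integral>\<^sup>+x. g ((x - a) / c) \<partial>lborel) = ennreal \<bar>c\<bar> * (\<integral>\<^sup>+y. g ((a + c * y - a) / c) \<partial>lborel)"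
    by (rule nn_integral_real_affine) (use c in auto)
  then show ?thesis using c by simp
qed

lemma nn_integral_inverse_1_plus_square_finite:
  "(\<integral>\<^sup>+y. ennreal (1 / (1 + (y::real)\<^sup>2)) \<partial>lborel) < top"
proof -
  have half: "(\<integral>\<^sup>+y. ennreal (1 / (1 + (y::real)\<^sup>2)) * indicator {0..} y \<partial>lborel) = ennreal (pi / 2 - arctan 0)"
  proof (rule nn_integral_FTC_atLeast)
    show "(arctan has_real_derivative 1 / (1 + y\<^sup>2)) (at y)" if "0 \<le> y" for y
      using DERIV_arctan[of y] by (simp add: divide_inverse)
    show "(arctan \<longlongrightarrow> pi / 2) at_top" by (rule tendsto_arctan_at_top)
  qed auto
  have "(\<integral>\<^sup>+y. ennreal (1 / (1 + (y::real)\<^sup>2)) \<partial>lborel)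
      \<le> (\<integral>\<^sup>+y. ennreal (1 / (1 + (y::real)\<^sup>2)) * indicator {0..} y + ennreal (1 / (1 + y\<^sup>2)) * indicator {0..} (- y) \<partial>lborel)"
    by (intro nn_integral_mono) (auto simp: indicator_def)
  also have "\<dots> = (\<integral>\<^sup>+y. ennreal (1 / (1 + (y::real)\<^sup>2)) * indicator {0..} y \<partial>lborel)
      + (\<integral>\<^sup>+y. ennreal (1 / (1 + (y::real)\<^sup>2)) * indicator {0..} (- y) \<partial>lborel)"
    by (intro nn_integral_add) auto
  also have "(\<integral>\<^sup>+y. ennreal (1 / (1 + (y::real)\<^sup>2)) * indicator {0..} (- y) \<partial>lborel)
      = (\<integral>\<^sup>+y. ennreal (1 / (1 + (y::real)\<^sup>2)) * indicator {0..} y \<partial>lborel)"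
    by (subst nn_integral_real_affine[where c = "-1" and t = 0]) auto
  finally show ?thesis using le_less_trans unfolding half by fastforce
qed

lemma nn_integral_weight_finite:
  fixes \<beta> q :: real
  assumes \<beta>: "0 < \<beta>" and q: "\<beta> < q"
  shows "(\<integral>\<^sup>+u\<in>{0<..}. ennreal ((1 + u) powr - q * u powr (\<beta> - 1)) \<partial>lborel) < top"
proof -
  have i0: "((\<lambda>u. u powr (\<beta> - 1)) has_integral (1 powr (\<beta> - 1 + 1) / (\<beta> - 1 + 1))) {0..1}"
    by (rule has_integral_powr_from_0) (use \<beta> in auto)
  have i1: "((\<lambda>u. u powr (\<beta> - 1 - q)) has_integral - (1 powr (\<beta> - 1 - q + 1)) / (\<beta> - 1 - q + 1)) {1..}"
    by (rule has_integral_powr_to_inf) (use q in auto)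
  have "(\<integral>\<^sup>+u\<in>{0<..}. ennreal ((1 + u) powr - q * u powr (\<beta> - 1)) \<partial>lborel)
      \<le> (\<integral>\<^sup>+u. ennreal (u powr (\<beta> - 1)) * indicator {0..1} u
             + ennreal (u powr (\<beta> - 1 - q)) * indicator {1..} u \<partial>lborel)"
  proof (rule nn_integral_mono)
    fix u :: real
    show "ennreal ((1 + u) powr - q * u powr (\<beta> - 1)) * indicator {0<..} u
      \<le> ennreal (u powr (\<beta> - 1)) * indicator {0..1} u + ennreal (u powr (\<beta> - 1 - q)) * indicator {1..} u"
    proof (cases "0 < u")
      case u: True
      show ?thesis
      proof (cases "u \<le> 1")
        case True
        have "(1 + u) powr - q \<le> 1 powr - q" using u \<beta> q by (intro powr_mono2') auto
        then have "(1 + u) powr - q * u powr (\<beta> - 1) \<le> u powr (\<beta> - 1)"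
          by (simp add: mult_left_le_one_le)
        then have "ennreal ((1 + u) powr - q * u powr (\<beta> - 1)) * indicator {0<..} u
            \<le> ennreal (u powr (\<beta> - 1)) * indicator {0..1} u"
          using u True by (auto intro: ennreal_leI)
        then show ?thesis by (rule order_trans) simp
      next
        case False
        have "(1 + u) powr - q \<le> u powr - q" using u \<beta> q by (intro powr_mono2') auto
        then have "(1 + u) powr - q * u powr (\<beta> - 1) \<le> u powr - q * u powr (\<beta> - 1)"
          by (intro mult_right_mono) auto
        also have "\<dots> = u powr (\<beta> - 1 - q)" using u by (simp add: powr_add[symmetric] algebra_simps)
        finally show ?thesis using u False by (auto intro: ennreal_leI)
      qed
    qed simp
  qed
  also have "\<dots> = (\<integral>\<^sup>+u. ennreal (u powr (\<beta> - 1)) * indicator {0..1} u \<partial>lborel)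
      + (\<integral>\<^sup>+u. ennreal (u powr (\<beta> - 1 - q)) * indicator {1..} u \<partial>lborel)"
    by (intro nn_integral_add) measurable
  also have "\<dots> < top"
    by (subst nn_integral_has_integral_lebesgue'[OF _ i0], simp,
        subst nn_integral_has_integral_lebesgue'[OF _ i1], simp_all)
  finally show ?thesis .
qed

text \<open>Reduces the integrability of a radial function on the whole space to that of \<open>1 / (1 + y\<^sup>2)\<close> on
  the line.\<close>

lemma prod_inverse_1_plus_square_ge:
  fixes y :: "'a::euclidean_space"
  assumes "real DIM('a) \<le> q"
  shows "(1 + (norm y)\<^sup>2) powr - q \<le> (\<Prod>b\<in>Basis. 1 / (1 + (y \<bullet> b)\<^sup>2))"
proof -
  have "(\<Prod>b\<in>(Basis::'a set). 1 + (y \<bullet> b)\<^sup>2) \<le> (\<Prod>b\<in>(Basis::'a set). 1 + (norm y)\<^sup>2)"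
  proof (rule prod_mono)
    fix b :: 'a assume "b \<in> Basis"
    then have "\<bar>y \<bullet> b\<bar> \<le> norm y" by (rule Basis_le_norm)
    then have "(y \<bullet> b)\<^sup>2 \<le> (norm y)\<^sup>2" by (metis abs_le_square_iff abs_norm_cancel)
    then show "0 \<le> 1 + (y \<bullet> b)\<^sup>2 \<and> 1 + (y \<bullet> b)\<^sup>2 \<le> 1 + (norm y)\<^sup>2" by simp
  qed
  also have "\<dots> = (1 + (norm y)\<^sup>2) powr DIM('a)" by (simp add: powr_realpow add_pos_nonneg)
  also have "\<dots> \<le> (1 + (norm y)\<^sup>2) powr q" using assms by (intro powr_mono) auto
  finally have le: "(\<Prod>b\<in>(Basis::'a set). 1 + (y \<bullet> b)\<^sup>2) \<le> (1 + (norm y)\<^sup>2) powr q" .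
  have pos: "0 < 1 + (norm y)\<^sup>2" by (simp add: add_pos_nonneg)
  then have nz: "1 + (norm y)\<^sup>2 \<noteq> 0" by linarith
  have "(1 + (norm y)\<^sup>2) powr - q = 1 / (1 + (norm y)\<^sup>2) powr q" by (simp add: powr_minus_divide)
  also have "\<dots> \<le> 1 / (\<Prod>b\<in>(Basis::'a set). 1 + (y \<bullet> b)\<^sup>2)"
    by (intro divide_left_mono le mult_pos_pos prod_pos) (auto simp: add_pos_nonneg nz)
  finally show ?thesis by (simp add: prod_dividef)
qed

text \<open>Both integrals scale: the inner one contributes \<open>t0 powr (\<alpha> * \<tau>)\<close>, which the exponent \<open>p / \<tau>\<close> turns
  into \<open>t0 powr (\<alpha> * p)\<close>, and the outer one \<open>t0 ^ CARD('n)\<close>. The decay makes the remaining integrals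
  finite: the first condition on \<open>q\<close> is for the vertical one, the second for the horizontal one.\<close>

lemma TL_norm_rescaled_le:
  fixes g :: "(real^'n) \<times> real \<Rightarrow> real" and \<tau> p \<alpha> q :: real
  assumes \<tau>: "0 < \<tau>" and p: "0 < p" and \<alpha>: "0 < \<alpha>"
    and q: "\<alpha> < 2 * q" "real CARD('n) \<le> q * p"
    and decay: "\<And>y u. 0 < u \<Longrightarrow> \<bar>g (y, u)\<bar> \<le> (1 + (norm y)\<^sup>2) powr - q * (1 + u) powr - (2 * q)"
  obtains B where "0 \<le> B"
    and "\<And>x0 t0. 0 < t0 \<Longrightarrow> TL_norm p \<tau> \<alpha> (\<lambda>(x, t). g ((x - x0) /\<^sub>R t0, t / t0))
           \<le> ennreal (B * t0 powr ((CARD('n) + \<alpha> * p) / p))"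
proof -
  let ?n = "CARD('n)"
  define w where "w = (\<lambda>u::real. ennreal ((1 + u) powr - (2 * q * \<tau>) * u powr (\<alpha> * \<tau> - 1)) * indicator {0<..} u)"
  have [measurable]: "w \<in> borel_measurable borel" unfolding w_def by measurable
  have q0: "0 < q" using q \<alpha> by simp
  have "\<alpha> * \<tau> < 2 * q * \<tau>" using q \<tau> by simp
  then have "(\<integral>\<^sup>+u. w u \<partial>lborel) < top"
    unfolding w_def using \<alpha> \<tau> by (intro nn_integral_weight_finite) auto
  then obtain V where V: "(\<integral>\<^sup>+u. w u \<partial>lborel) = ennreal V" "0 \<le> V"
    by (cases "\<integral>\<^sup>+u. w u \<partial>lborel") auto
  obtain A where A: "(\<integral>\<^sup>+y. ennreal (1 / (1 + (y::real)\<^sup>2)) \<partial>lborel) = ennreal A" "0 \<le> A"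
    using nn_integral_inverse_1_plus_square_finite
    by (cases "\<integral>\<^sup>+y. ennreal (1 / (1 + (y::real)\<^sup>2)) \<partial>lborel") auto
  define B where "B = (V powr (p / \<tau>) * A ^ ?n) powr (1 / p)"
  show thesis
  proof (rule that[of B])
    show "0 \<le> B" by (simp add: B_def)
    fix x0 :: "real^'n" and t0 :: real assume t0: "0 < t0"
    let ?f = "\<lambda>(x, t). g ((x - x0) /\<^sub>R t0, t / t0)"
    let ?R = "\<lambda>x. 1 + (norm ((x - x0) /\<^sub>R t0))\<^sup>2"
    have R: "0 < ?R x" for x by (simp add: add_pos_nonneg)
    have inner: "(\<integral>\<^sup>+t. TL_density \<tau> \<alpha> ?f (x, t) \<partial>lborel) \<le> ennreal (?R x powr - (q * \<tau>) * t0 powr (\<alpha> * \<tau>) * V)" for x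
    proof -
      have "(\<integral>\<^sup>+t. TL_density \<tau> \<alpha> ?f (x, t) \<partial>lborel)
          \<le> (\<integral>\<^sup>+t. ennreal (?R x powr - (q * \<tau>) * t0 powr (\<alpha> * \<tau> - 1)) * w ((t - 0) / t0) \<partial>lborel)"
      proof (rule nn_integral_mono)
        fix t :: real
        show "TL_density \<tau> \<alpha> ?f (x, t) \<le> ennreal (?R x powr - (q * \<tau>) * t0 powr (\<alpha> * \<tau> - 1)) * w ((t - 0) / t0)"
        proof (cases "0 < t")
          case t: True
          have "\<bar>?f (x, t)\<bar> powr \<tau> \<le> (?R x powr - q * (1 + t / t0) powr - (2 * q)) powr \<tau>"
            using \<tau> t t0 decay[of "t / t0" "(x - x0) /\<^sub>R t0"] by (intro powr_mono2) auto
          also have "\<dots> = ?R x powr - (q * \<tau>) * (1 + t / t0) powr - (2 * q * \<tau>)"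
            by (simp add: powr_mult powr_powr)
          finally have "\<bar>?f (x, t)\<bar> powr \<tau> * t powr (\<alpha> * \<tau> - 1)
              \<le> ?R x powr - (q * \<tau>) * (1 + t / t0) powr - (2 * q * \<tau>) * t powr (\<alpha> * \<tau> - 1)"
            by (rule mult_right_mono) simp
          also have "\<dots> = ?R x powr - (q * \<tau>) * t0 powr (\<alpha> * \<tau> - 1)
                  * ((1 + t / t0) powr - (2 * q * \<tau>) * (t / t0) powr (\<alpha> * \<tau> - 1))"
            using t t0 by (simp add: powr_divide)
          finally have "ennreal (\<bar>?f (x, t)\<bar> powr \<tau> * t powr (\<alpha> * \<tau> - 1))
              \<le> ennreal (?R x powr - (q * \<tau>) * t0 powr (\<alpha> * \<tau> - 1)
                  * ((1 + t / t0) powr - (2 * q * \<tau>) * (t / t0) powr (\<alpha> * \<tau> - 1)))"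
            by (rule ennreal_leI)
          also have "\<dots> = ennreal (?R x powr - (q * \<tau>) * t0 powr (\<alpha> * \<tau> - 1)) * w ((t - 0) / t0)"
            using t t0 by (subst ennreal_mult) (auto simp: w_def)
          finally show ?thesis using t by (simp add: TL_density_def)
        qed (simp add: TL_density_def)
      qed
      also have "\<dots> = ennreal (?R x powr - (q * \<tau>) * t0 powr (\<alpha> * \<tau> - 1)) * (ennreal t0 * ennreal V)"
        using nn_integral_scale_real[of w t0 0] t0 V(1) by (subst nn_integral_cmult) simp_all
      also have "\<dots> = ennreal (?R x powr - (q * \<tau>) * (t0 powr (\<alpha> * \<tau> - 1) * t0) * V)"
        using t0 V by (simp add: mult_ac flip: ennreal_mult)
      also have "t0 powr (\<alpha> * \<tau> - 1) * t0 = t0 powr (\<alpha> * \<tau>)"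
        using t0 powr_mult_base[of t0 "\<alpha> * \<tau> - 1"] by (simp add: mult.commute)
      finally show ?thesis .
    qed
    have "(\<integral>\<^sup>+x. enn_powr (\<integral>\<^sup>+t. TL_density \<tau> \<alpha> ?f (x, t) \<partial>lborel) (p / \<tau>) \<partial>lborel)
        \<le> (\<integral>\<^sup>+x. ennreal (t0 powr (\<alpha> * p) * V powr (p / \<tau>)) *
              (\<Prod>b\<in>Basis. ennreal (1 / (1 + ((x \<bullet> b - x0 \<bullet> b) / t0)\<^sup>2))) \<partial>lborel)"
    proof (rule nn_integral_mono)
      fix x :: "real^'n"
      have "enn_powr (\<integral>\<^sup>+t. TL_density \<tau> \<alpha> ?f (x, t) \<partial>lborel) (p / \<tau>)
          \<le> enn_powr (ennreal (?R x powr - (q * \<tau>) * t0 powr (\<alpha> * \<tau>) * V)) (p / \<tau>)"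
        using p \<tau> by (intro enn_powr_mono inner) auto
      also have "\<dots> = ennreal (?R x powr - (q * p) * (t0 powr (\<alpha> * p) * V powr (p / \<tau>)))"
        using V p \<tau> by (simp add: enn_powr_ennreal powr_mult powr_powr mult.assoc)
      also have "\<dots> \<le> ennreal ((\<Prod>b\<in>Basis. 1 / (1 + (((x - x0) /\<^sub>R t0) \<bullet> b)\<^sup>2)) * (t0 powr (\<alpha> * p) * V powr (p / \<tau>)))"
        using q by (intro ennreal_leI mult_right_mono prod_inverse_1_plus_square_ge) auto
      also have "\<dots> = ennreal (t0 powr (\<alpha> * p) * V powr (p / \<tau>)) *
          (\<Prod>b\<in>Basis. ennreal (1 / (1 + ((x \<bullet> b - x0 \<bullet> b) / t0)\<^sup>2)))"
        by (subst ennreal_mult) (auto simp: prod_ennreal prod_nonneg inner_diff_left divide_inverse mult.commute add_nonneg_nonneg intro!: prod_nonneg)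
      finally show "enn_powr (\<integral>\<^sup>+t. TL_density \<tau> \<alpha> ?f (x, t) \<partial>lborel) (p / \<tau>)
          \<le> ennreal (t0 powr (\<alpha> * p) * V powr (p / \<tau>)) * (\<Prod>b\<in>Basis. ennreal (1 / (1 + ((x \<bullet> b - x0 \<bullet> b) / t0)\<^sup>2)))" .
    qed
    also have "\<dots> = ennreal (t0 powr (\<alpha> * p) * V powr (p / \<tau>)) *
        (\<integral>\<^sup>+x. (\<Prod>b\<in>Basis. ennreal (1 / (1 + ((x \<bullet> b - x0 \<bullet> b) / t0)\<^sup>2))) \<partial>(lborel :: (real^'n) measure))"
      by (rule nn_integral_cmult) measurable
    also have "(\<integral>\<^sup>+x. (\<Prod>b\<in>Basis. ennreal (1 / (1 + ((x \<bullet> b - x0 \<bullet> b) / t0)\<^sup>2))) \<partial>(lborel :: (real^'n) measure))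
        = (\<Prod>b\<in>(Basis :: (real^'n) set). \<integral>\<^sup>+y. ennreal (1 / (1 + ((y - x0 \<bullet> b) / t0)\<^sup>2)) \<partial>lborel)"
      by (rule nn_integral_lborel_prod[of "\<lambda>b y. ennreal (1 / (1 + ((y - x0 \<bullet> b) / t0)\<^sup>2))"]) auto
    also have "\<dots> = (\<Prod>b\<in>(Basis :: (real^'n) set). ennreal t0 * ennreal A)"
    proof (rule prod.cong[OF refl])
      fix b :: "real^'n"
      show "(\<integral>\<^sup>+y. ennreal (1 / (1 + ((y - x0 \<bullet> b) / t0)\<^sup>2)) \<partial>lborel) = ennreal t0 * ennreal A"
        using nn_integral_scale_real[of "\<lambda>y. ennreal (1 / (1 + y\<^sup>2))" t0 "x0 \<bullet> b"] t0 by (simp add: A)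
    qed
    also have "\<dots> = ennreal ((t0 * A) ^ ?n)" using t0 A by (simp add: ennreal_power flip: ennreal_mult)
    also have "ennreal (t0 powr (\<alpha> * p) * V powr (p / \<tau>)) * ennreal ((t0 * A) ^ ?n)
        = ennreal ((V powr (p / \<tau>) * A ^ ?n) * t0 powr (?n + \<alpha> * p))"
      using t0 A by (simp add: powr_add powr_realpow power_mult_distrib mult_ac flip: ennreal_mult)
    finally have "TL_norm p \<tau> \<alpha> ?f \<le> enn_powr (ennreal ((V powr (p / \<tau>) * A ^ ?n) * t0 powr (?n + \<alpha> * p))) (1 / p)"
      unfolding TL_norm_eq using p by (intro enn_powr_mono) auto
    also have "\<dots> = ennreal (B * t0 powr ((?n + \<alpha> * p) / p))"
      using A by (simp add: enn_powr_ennreal powr_mult powr_powr B_def)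
    finally show "TL_norm p \<tau> \<alpha> ?f \<le> ennreal (B * t0 powr ((?n + \<alpha> * p) / p))" .
  qed
qed

section \<open>Testing the embedding\<close>

text \<open>All test functions are translates and dilates of one Kelvin transform with its pole at height
  \<open>-1\<close>, moved so that the pole lies at the reflection \<open>(x0, - t0)\<close> of the point \<open>(x0, t0)\<close>. The
  normalised function is non-zero at the point corresponding to \<open>(x0, t0)\<close>, hence bounded away from
  zero on a ball of radius proportional to \<open>t0\<close>.\<close>

lemma test_functions:
  fixes \<tau> p \<alpha> :: real
  assumes \<tau>: "0 < \<tau>" and p: "0 < p" and \<alpha>: "0 < \<alpha>"
  obtains F :: "(real^'n) \<Rightarrow> real \<Rightarrow> (real^'n) \<times> real \<Rightarrow> real" and B \<delta> c :: real
    where "0 \<le> B" "0 < \<delta>" "\<delta> < 1" "0 < c"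
    and "\<And>x0 t0. 0 < t0 \<Longrightarrow> harmonic_on (F x0 t0) upper_halfspace"
    and "\<And>x0 t0. 0 < t0 \<Longrightarrow> TL_norm p \<tau> \<alpha> (F x0 t0) \<le> ennreal (B * t0 powr ((CARD('n) + \<alpha> * p) / p))"
    and "\<And>x0 t0 z. 0 < t0 \<Longrightarrow> z \<in> cball (x0, t0) (\<delta> * t0) \<Longrightarrow> c \<le> \<bar>F x0 t0 z\<bar>"
proof -
  obtain j where j: "max 1 (max \<alpha> (CARD('n) / p)) < real j" using reals_Archimedean2 by blast
  then have j1: "1 \<le> j" and jq: "\<alpha> < 2 * real j" "real CARD('n) \<le> real j * p"
    using p \<alpha> by (auto simp: pos_divide_less_eq)
  obtain b :: "real^'n" where b: "b \<in> Basis" using nonempty_Basis by blast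
  let ?e1 = "(0, 1) :: (real^'n) \<times> real" and ?e2 = "(b, 0) :: (real^'n) \<times> real"
  have e: "?e1 \<in> Basis" "?e2 \<in> Basis" "?e1 \<noteq> ?e2" using b by (auto simp: Basis_prod_def)
  \<comment> \<open>the fourth power of the norm of \<open>(y, u + 1)\<close> dominates \<open>(1 + (norm y)\<^sup>2) * (1 + u)\<^sup>2\<close>, so the
      exponent \<open>4 * j\<close> gives the decay exponent \<open>j\<close> in both factors\<close>
  let ?k = "kelvin_power (4 * j) ?e1 ?e2"
  let ?S = "- {0 :: (real^'n) \<times> real}"
  have harm: "harmonic_on ?k ?S" by (rule harmonic_kelvin_power[OF e]) (use j1 in simp)
  define g where "g = (\<lambda>(y, u). ?k (y, u + 1))"
  have decay: "\<bar>g (y, u)\<bar> \<le> (1 + (norm y)\<^sup>2) powr - real j * (1 + u) powr - (2 * real j)"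
    if u: "0 < u" for y u
  proof -
    let ?\<zeta> = "(y, u + 1)"
    have n2: "(norm ?\<zeta>)\<^sup>2 = (norm y)\<^sup>2 + (1 + u)\<^sup>2"
      by (simp add: norm_prod_def add.commute)
    have u2: "1 \<le> (1 + u)\<^sup>2" using u by (simp add: one_le_power)
    have "1 \<le> (norm ?\<zeta>)\<^sup>2" using u2 zero_le_power2[of "norm y"] unfolding n2 by linarith
    then have n1: "1 \<le> norm ?\<zeta>" by (intro power2_le_imp_le[of 1]) simp_all
    have R: "0 < 1 + (norm y)\<^sup>2" by (simp add: add_pos_nonneg)
    have "(1 + (norm y)\<^sup>2) * (1 + u)\<^sup>2 \<le> (norm ?\<zeta>)\<^sup>2 * (norm ?\<zeta>)\<^sup>2"
      unfolding n2 using u2 by (intro mult_mono) auto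
    also have "\<dots> = norm ?\<zeta> ^ 4" by (simp flip: power_add)
    finally have "((1 + (norm y)\<^sup>2) * (1 + u)\<^sup>2) ^ j \<le> norm ?\<zeta> ^ (4 * j)"
      unfolding power_mult using R by (intro power_mono) auto
    then have "1 / norm ?\<zeta> ^ (4 * j) \<le> 1 / ((1 + (norm y)\<^sup>2) * (1 + u)\<^sup>2) ^ j"
      using R u by (intro frac_le) auto
    moreover have "\<bar>g (y, u)\<bar> \<le> 1 / norm ?\<zeta> ^ (4 * j)"
      unfolding g_def prod.case by (rule kelvin_power_decay[OF e n1]) simp
    moreover have "(1 + (norm y)\<^sup>2) powr - real j * (1 + u) powr - (2 * real j)
        = 1 / ((1 + (norm y)\<^sup>2) * (1 + u)\<^sup>2) ^ j"
    proof -
      have "(1 + (norm y)\<^sup>2) powr - real j = 1 / (1 + (norm y)\<^sup>2) ^ j"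
        using R by (simp only: powr_minus_divide powr_realpow)
      moreover have "(1 + u) powr - (2 * real j) = 1 / ((1 + u)\<^sup>2) ^ j"
        using u powr_realpow[of "1 + u" "2 * j"] by (simp add: powr_minus_divide power_mult)
      ultimately show ?thesis by (simp add: power_mult_distrib)
    qed
    ultimately show ?thesis by linarith
  qed
  obtain B where B: "0 \<le> B" and TL: "\<And>x0 t0. 0 < t0 \<Longrightarrow> TL_norm p \<tau> \<alpha> (\<lambda>(x, t). g ((x - x0) /\<^sub>R t0, t / t0))
           \<le> ennreal (B * t0 powr ((CARD('n) + \<alpha> * p) / p))"
    by (rule TL_norm_rescaled_le[OF \<tau> p \<alpha> jq decay]) (assumption, rule that)
  define F where "F = (\<lambda>x0 t0 z. ?k ((1 / t0) *\<^sub>R (z - (x0, t0)) + (0, 2)))"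
  have F_eq: "F x0 t0 = (\<lambda>(x, t). g ((x - x0) /\<^sub>R t0, t / t0))" if "0 < t0" for x0 t0
    using that by (auto simp: F_def g_def fun_eq_iff divide_inverse algebra_simps)
  have "\<forall>z\<in>?S. isCont ?k z"
    using harmonic_on_imp_continuous_on[OF harm] by (subst (asm) continuous_on_eq_continuous_at) auto
  then have cont: "isCont ?k (0, 2)" by (auto simp: zero_prod_def)
  have k0: "0 < ?k (0, 2)"
  proof -
    have "plane_coord ?e1 ?e2 (0, 2) = 2" by (simp add: plane_coord_def complex_eq_iff)
    moreover have "Re ((2 :: complex) ^ (4 * j)) = 2 ^ (4 * j)"
      by (metis Re_complex_of_real of_real_numeral of_real_power)
    ultimately show ?thesis unfolding kelvin_power_def by simp
  qed
  obtain d where d: "0 < d" "\<And>w. dist w (0, 2) < d \<Longrightarrow> dist (?k w) (?k (0, 2)) < ?k (0, 2) / 2"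
    using cont[unfolded continuous_at_eps_delta, THEN spec, THEN mp, OF half_gt_zero[OF k0]] by blast
  define \<delta> where "\<delta> = min (d / 2) (1 / 2)"
  show thesis
  proof (rule that[of B \<delta> "?k (0, 2) / 2" F])
    show "0 \<le> B" "0 < \<delta>" "\<delta> < 1" "0 < ?k (0, 2) / 2" using B d k0 by (auto simp: \<delta>_def)
    fix x0 :: "real^'n" and t0 :: real assume t0: "0 < t0"
    show "harmonic_on (F x0 t0) upper_halfspace"
      unfolding F_def using harm
    proof (rule harmonic_on_affine)
      fix z :: "(real^'n) \<times> real" assume "z \<in> upper_halfspace"
      then have "0 < snd ((1 / t0) *\<^sub>R (z - (x0, t0)) + (0, 2))"
        using t0 by (auto simp: upper_halfspace_def field_simps)
      then show "(1 / t0) *\<^sub>R (z - (x0, t0)) + (0, 2) \<in> ?S"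
        by (metis ComplI less_irrefl singletonD snd_zero)
    qed
    show "TL_norm p \<tau> \<alpha> (F x0 t0) \<le> ennreal (B * t0 powr ((CARD('n) + \<alpha> * p) / p))"
      unfolding F_eq[OF t0] by (rule TL[OF t0])
    fix z assume "z \<in> cball (x0, t0) (\<delta> * t0)"
    then have "norm ((1 / t0) *\<^sub>R (z - (x0, t0))) \<le> \<delta>"
      using t0 by (simp add: dist_norm norm_minus_commute[of z] pos_divide_le_eq)
    also have "\<delta> < d" using d by (auto simp: \<delta>_def min_def)
    finally have "dist (F x0 t0 z) (?k (0, 2)) < ?k (0, 2) / 2"
      unfolding F_def by (intro d(2)) (simp add: dist_norm)
    then show "?k (0, 2) / 2 \<le> \<bar>F x0 t0 z\<bar>" unfolding dist_real_def by arith
  qed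
qed

text \<open>The map \<open>(x, t) \<mapsto> ((x - \<xi>) / \<eta>, t / \<eta>)\<close> sends every cube of this shape into one compact subset of
  the half-space. A finite cover of that set by balls, pulled back, covers each cube by a number of
  balls that does not depend on the cube.\<close>

lemma bounded_height_cover:
  fixes a b \<delta> :: real
  assumes a: "0 < a" and \<delta>: "0 < \<delta>"
  obtains W :: "((real^'n) \<times> real) set" where "finite W" "\<And>y u. (y, u) \<in> W \<Longrightarrow> 0 < u"
    and "\<And>\<xi> \<eta> s. 0 < \<eta> \<Longrightarrow> s \<le> 2 * \<eta> \<Longrightarrow> cube (\<xi>, \<eta>) s \<subseteq> UNIV \<times> {a * \<eta>..b * \<eta>} \<Longrightarrow>
      cube (\<xi>, \<eta>) s \<subseteq> (\<Union>(y, u)\<in>W. cball (\<xi> + \<eta> *\<^sub>R y, \<eta> * u) (\<delta> * (\<eta> * u)))"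
proof -
  define K where "K = cube (0 :: real^'n) 2 \<times> {a..b}"
  have "compact K" by (simp add: K_def cube_def compact_Times)
  moreover have "K \<subseteq> (\<Union>w\<in>K. ball w (\<delta> * snd w))" using a \<delta> by (force simp: K_def)
  ultimately obtain W where W: "W \<subseteq> K" "finite W" "K \<subseteq> (\<Union>w\<in>W. ball w (\<delta> * snd w))"
    by (rule compactE_image[OF _ open_ball])
  show thesis
  proof (rule that[OF W(2)])
    show "0 < u" if "(y, u) \<in> W" for y u using that W(1) a by (auto simp: K_def)
    fix \<xi> :: "real^'n" and \<eta> s :: real
    assume \<eta>: "0 < \<eta>" and s: "s \<le> 2 * \<eta>" and height: "cube (\<xi>, \<eta>) s \<subseteq> UNIV \<times> {a * \<eta>..b * \<eta>}"
    show "cube (\<xi>, \<eta>) s \<subseteq> (\<Union>(y, u)\<in>W. cball (\<xi> + \<eta> *\<^sub>R y, \<eta> * u) (\<delta> * (\<eta> * u)))"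
    proof
      fix z assume z: "z \<in> cube (\<xi>, \<eta>) s"
      obtain x t where xt: "z = (x, t)" by (cases z)
      have x: "x \<in> cube \<xi> s" using z unfolding xt by (rule mem_cube_prodD)
      have t: "a * \<eta> \<le> t" "t \<le> b * \<eta>" using z height by (auto simp: xt)
      let ?w = "((x - \<xi>) /\<^sub>R \<eta>, t / \<eta>)"
      have "(x - \<xi>) /\<^sub>R \<eta> \<in> cube 0 2"
      proof -
        have "\<bar>(x - \<xi>) \<bullet> i\<bar> \<le> \<eta>" if "i \<in> Basis" for i
          using x that s by (force simp: mem_cube)
        then have "\<bar>inverse \<eta> * ((x - \<xi>) \<bullet> i)\<bar> \<le> 1" if "i \<in> Basis" for i
          using \<eta> that by (simp add: abs_mult field_simps)
        then show ?thesis by (simp add: mem_cube)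
      qed
      then have "?w \<in> K" using t \<eta> by (auto simp: K_def field_simps)
      then obtain w where w: "w \<in> W" "?w \<in> ball w (\<delta> * snd w)" using W(3) by auto
      obtain y u where yu: "w = (y, u)" by (cases w)
      have "(\<xi> + \<eta> *\<^sub>R y, \<eta> * u) - z = \<eta> *\<^sub>R (w - ?w)"
        using \<eta> by (simp add: xt yu algebra_simps)
      then have "dist (\<xi> + \<eta> *\<^sub>R y, \<eta> * u) z = \<eta> * dist w ?w"
        using \<eta> by (simp add: dist_norm)
      also have "\<dots> \<le> \<eta> * (\<delta> * u)" using w(2) \<eta> by (intro mult_left_mono) (auto simp: yu)
      finally have "z \<in> cball (\<xi> + \<eta> *\<^sub>R y, \<eta> * u) (\<delta> * (\<eta> * u))" by (simp add: mult_ac)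
      then show "z \<in> (\<Union>(y, u)\<in>W. cball (\<xi> + \<eta> *\<^sub>R y, \<eta> * u) (\<delta> * (\<eta> * u)))"
        using w(1) unfolding yu by (auto simp del: mem_cball)
    qed
  qed
qed

text \<open>Applied to the test function of \<open>(x0, t0)\<close>, the embedding bounds the measure of a ball around that
  point by a constant times \<open>t0 powr (CARD('n) + \<alpha> * p)\<close>. Boundedly many such balls, with heights
  comparable to \<open>\<eta> k\<close>, cover the \<open>k\<close>-th Whitney cube.\<close>

lemma carleson_if_embedded:
  fixes \<xi> :: "nat \<Rightarrow> real^'n" and \<eta> s :: "nat \<Rightarrow> real"
    and \<mu> :: "((real^'n) \<times> real) measure" and C p \<tau> \<alpha> :: real
  assumes whitney: "whitney_decomposition \<xi> \<eta> s"
    and \<tau>: "0 < \<tau>" and p: "0 < p" and \<alpha>: "0 < \<alpha>"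
    and space: "space \<mu> = upper_halfspace"
    and sets: "sets \<mu> = sets (restrict_space borel upper_halfspace)"
    and C: "0 \<le> C" and emb: "\<And>f. f \<in> TL_space p \<tau> \<alpha> \<Longrightarrow> Lp_norm p \<mu> f \<le> ennreal C * TL_norm p \<tau> \<alpha> f"
  obtains M where "0 \<le> M"
    and "\<And>k. k \<ge> 1 \<Longrightarrow> emeasure \<mu> (cube (\<xi> k, \<eta> k) (s k)) \<le> ennreal (M * \<eta> k powr (real CARD('n) + \<alpha> * p))"
proof -
  let ?e = "real CARD('n) + \<alpha> * p" and ?U = "upper_halfspace :: ((real^'n) \<times> real) set"
  obtain F :: "(real^'n) \<Rightarrow> real \<Rightarrow> (real^'n) \<times> real \<Rightarrow> real" and B \<delta> c :: real
    where B: "0 \<le> B" and \<delta>: "0 < \<delta>" "\<delta> < 1" and c: "0 < c"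
    and harm: "\<And>x0 t0. 0 < t0 \<Longrightarrow> harmonic_on (F x0 t0) upper_halfspace"
    and TL: "\<And>x0 t0. 0 < t0 \<Longrightarrow> TL_norm p \<tau> \<alpha> (F x0 t0) \<le> ennreal (B * t0 powr (?e / p))"
    and large: "\<And>x0 t0 z. 0 < t0 \<Longrightarrow> z \<in> cball (x0, t0) (\<delta> * t0) \<Longrightarrow> c \<le> \<bar>F x0 t0 z\<bar>"
    by (rule test_functions[OF \<tau> p \<alpha>]) (rule that)
  define D where "D = (C * B) powr p / c powr p"
  have D: "0 \<le> D" by (simp add: D_def)
  have ball_sub: "cball (x0, t0) (\<delta> * t0) \<subseteq> ?U" if "0 < t0" for x0 :: "real^'n" and t0 :: real
  proof
    fix z assume "z \<in> cball (x0, t0) (\<delta> * t0)"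
    then have "\<bar>t0 - snd z\<bar> \<le> \<delta> * t0"
      using dist_snd_le[of "(x0, t0)" z] by (simp add: dist_real_def)
    moreover have "\<delta> * t0 < t0" using \<delta> that by simp
    ultimately show "z \<in> ?U" by (auto simp: upper_halfspace_def case_prod_beta)
  qed
  have ball_sets: "cball (x0, t0) (\<delta> * t0) \<in> sets \<mu>" if "0 < t0" for x0 :: "real^'n" and t0 :: real
    by (intro borel_subset_upper_halfspace_in_sets[OF sets] ball_sub that) simp
  have ball: "emeasure \<mu> (cball (x0, t0) (\<delta> * t0)) \<le> ennreal (D * t0 powr ?e)"
    if t0: "0 < t0" for x0 :: "real^'n" and t0 :: real
  proof -
    let ?f = "F x0 t0" and ?A = "cball (x0, t0) (\<delta> * t0)"
    have "TL_norm p \<tau> \<alpha> ?f < \<infinity>" by (rule le_less_trans[OF TL[OF t0]]) simp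
    then have "?f \<in> TL_space p \<tau> \<alpha>" using harm[OF t0] by (simp add: TL_space_def)
    then have "Lp_norm p \<mu> ?f \<le> ennreal C * TL_norm p \<tau> \<alpha> ?f" by (rule emb)
    also have "\<dots> \<le> ennreal C * ennreal (B * t0 powr (?e / p))" by (intro mult_left_mono TL t0) simp
    also have "\<dots> = ennreal (C * B * t0 powr (?e / p))" using B C by (simp add: mult.assoc flip: ennreal_mult)
    finally have "enn_powr (Lp_norm p \<mu> ?f) p \<le> enn_powr (ennreal (C * B * t0 powr (?e / p))) p"
      using p by (intro enn_powr_mono) auto
    also have "enn_powr (ennreal (C * B * t0 powr (?e / p))) p = ennreal ((C * B) powr p * t0 powr ?e)"
      using p B C by (simp add: enn_powr_ennreal powr_mult powr_powr)
    also have "enn_powr (Lp_norm p \<mu> ?f) p = (\<integral>\<^sup>+z. ennreal (\<bar>?f z\<bar> powr p) \<partial>\<mu>)"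
      using p by (simp add: Lp_norm_def enn_powr_enn_powr)
    finally have upper: "(\<integral>\<^sup>+z. ennreal (\<bar>?f z\<bar> powr p) \<partial>\<mu>) \<le> ennreal ((C * B) powr p * t0 powr ?e)" .
    have "ennreal (c powr p) * emeasure \<mu> ?A = (\<integral>\<^sup>+z. ennreal (c powr p) * indicator ?A z \<partial>\<mu>)"
      by (rule nn_integral_cmult_indicator[symmetric, OF ball_sets[OF t0]])
    also have "\<dots> \<le> (\<integral>\<^sup>+z. ennreal (\<bar>?f z\<bar> powr p) \<partial>\<mu>)"
      using large[OF t0] c p
      by (intro nn_integral_mono) (auto simp: indicator_def simp del: mem_cball intro!: ennreal_leI powr_mono2)
    also note upper
    finally have "ennreal (1 / c powr p) * (ennreal (c powr p) * emeasure \<mu> ?A)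
        \<le> ennreal (1 / c powr p) * ennreal ((C * B) powr p * t0 powr ?e)"
      by (rule mult_left_mono) simp
    also have "ennreal (1 / c powr p) * (ennreal (c powr p) * emeasure \<mu> ?A) = emeasure \<mu> ?A"
      using c by (simp add: mult.assoc[symmetric] flip: ennreal_mult)
    also have "ennreal (1 / c powr p) * ennreal ((C * B) powr p * t0 powr ?e) = ennreal (D * t0 powr ?e)"
      by (simp add: D_def flip: ennreal_mult)
    finally show ?thesis .
  qed
  obtain a b \<kappa> N where a: "0 < a"
    and geo: "\<And>k. k \<ge> 1 \<Longrightarrow> 0 < \<eta> k \<and> 0 < s k \<and> s k \<le> 2 * \<eta> k \<and> 8 * \<kappa> * \<eta> k \<le> s k"
    and height: "\<And>k x t. k \<ge> 1 \<Longrightarrow> (x, t) \<in> cube (\<xi> k, \<eta> k) (5 / 4 * s k) \<Longrightarrow> a * \<eta> k \<le> t \<and> t \<le> b * \<eta> k"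
    by (rule whitney_geometry[OF whitney]) (rule that)
  obtain W :: "((real^'n) \<times> real) set" where W: "finite W" "\<And>y u. (y, u) \<in> W \<Longrightarrow> 0 < u"
    and cover: "\<And>\<xi> \<eta> s. 0 < \<eta> \<Longrightarrow> s \<le> 2 * \<eta> \<Longrightarrow> cube (\<xi>, \<eta>) s \<subseteq> UNIV \<times> {a * \<eta>..b * \<eta>} \<Longrightarrow>
      cube (\<xi>, \<eta>) s \<subseteq> (\<Union>(y, u)\<in>W. cball (\<xi> + \<eta> *\<^sub>R y, \<eta> * u) (\<delta> * (\<eta> * u)))"
    by (rule bounded_height_cover[OF a \<delta>(1)]) (rule that)
  define M where "M = (\<Sum>(y, u)\<in>W. D * u powr ?e)"
  show thesis
  proof (rule that)
    show "0 \<le> M" unfolding M_def using D by (intro sum_nonneg) auto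
    fix k :: nat assume k: "k \<ge> 1"
    have \<eta>: "0 < \<eta> k" using geo[OF k] by simp
    let ?B = "\<lambda>(y, u). cball (\<xi> k + \<eta> k *\<^sub>R y, \<eta> k * u) (\<delta> * (\<eta> k * u))"
    have B_sets: "?B ` W \<subseteq> sets \<mu>" using W(2) \<eta> ball_sets by auto
    have "cube (\<xi> k, \<eta> k) (s k) \<subseteq> cube (\<xi> k, \<eta> k) (5 / 4 * s k)"
      using geo[OF k] by (intro cube_mono) auto
    then have "cube (\<xi> k, \<eta> k) (s k) \<subseteq> UNIV \<times> {a * \<eta> k..b * \<eta> k}"
      using height[OF k] by auto
    then have "cube (\<xi> k, \<eta> k) (s k) \<subseteq> (\<Union>w\<in>W. ?B w)"
      using geo[OF k] by (intro cover) auto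
    then have "emeasure \<mu> (cube (\<xi> k, \<eta> k) (s k)) \<le> emeasure \<mu> (\<Union>w\<in>W. ?B w)"
      using B_sets W(1) by (intro emeasure_mono sets.finite_UN) auto
    also have "\<dots> \<le> (\<Sum>w\<in>W. emeasure \<mu> (?B w))"
      by (rule emeasure_subadditive_finite[OF W(1) B_sets])
    also have "\<dots> \<le> (\<Sum>(y, u)\<in>W. ennreal (D * u powr ?e * \<eta> k powr ?e))"
    proof (rule sum_mono)
      fix w assume w: "w \<in> W"
      obtain y u where yu: "w = (y, u)" by (cases w)
      have "0 < u" using w W(2) yu by blast
      then show "emeasure \<mu> (?B w) \<le> (case w of (y, u) \<Rightarrow> ennreal (D * u powr ?e * \<eta> k powr ?e))"
        using ball[of "\<eta> k * u" "\<xi> k + \<eta> k *\<^sub>R y"] \<eta> by (simp add: yu powr_mult mult_ac)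
    qed
    also have "\<dots> = ennreal (\<Sum>(y, u)\<in>W. D * u powr ?e * \<eta> k powr ?e)"
      using D by (subst sum_ennreal[symmetric]) (auto simp: case_prod_beta)
    also have "(\<Sum>(y, u)\<in>W. D * u powr ?e * \<eta> k powr ?e) = M * \<eta> k powr ?e"
      by (simp add: M_def sum_distrib_right case_prod_beta)
    finally show "emeasure \<mu> (cube (\<xi> k, \<eta> k) (s k)) \<le> ennreal (M * \<eta> k powr ?e)" .
  qed
qed

section \<open>The equivalence\<close>

theorem theorem4:
  fixes \<xi> :: "nat \<Rightarrow> real^'n" and \<eta> s :: "nat \<Rightarrow> real"
    and \<mu> :: "((real^'n) \<times> real) measure"
    and \<tau> p \<alpha> :: real
  assumes "whitney_decomposition \<xi> \<eta> s"
    and "0 < \<tau>" and "\<tau> \<le> p" and "\<alpha> > 0"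
    and "space \<mu> = upper_halfspace"
    and "sets \<mu> = sets (restrict_space borel upper_halfspace)"
  shows "(\<exists>C::real. C \<ge> 0 \<and>
            (\<forall>k\<ge>1. emeasure \<mu> (cube (\<xi> k, \<eta> k) (s k))
                     \<le> ennreal (C * \<eta> k powr (real CARD('n) + \<alpha> * p))))
     \<longleftrightarrow> continuously_embedded
           (TL_space p \<tau> \<alpha>) (TL_norm p \<tau> \<alpha>) (Lp_space p \<mu>) (Lp_norm p \<mu>)"
proof
  assume "\<exists>C::real. C \<ge> 0 \<and> (\<forall>k\<ge>1. emeasure \<mu> (cube (\<xi> k, \<eta> k) (s k))
            \<le> ennreal (C * \<eta> k powr (real CARD('n) + \<alpha> * p)))"
  then obtain C where C: "C \<ge> 0" "\<And>k. k \<ge> 1 \<Longrightarrow> emeasure \<mu> (cube (\<xi> k, \<eta> k) (s k))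
            \<le> ennreal (C * \<eta> k powr (real CARD('n) + \<alpha> * p))" by blast
  obtain B :: real where B: "B \<ge> 0"
    and bound: "\<And>f. harmonic_on f upper_halfspace \<Longrightarrow> Lp_norm p \<mu> f \<le> ennreal B * TL_norm p \<tau> \<alpha> f"
    by (rule Lp_norm_le_TL_norm[OF assms(1-3,5,6) C]) (assumption, rule that)
  have "f \<in> Lp_space p \<mu>" if "f \<in> TL_space p \<tau> \<alpha>" for f
  proof -
    have f: "harmonic_on f upper_halfspace" "TL_norm p \<tau> \<alpha> f < \<infinity>"
      using that by (auto simp: TL_space_def)
    have "ennreal B * TL_norm p \<tau> \<alpha> f < \<infinity>" using f(2) by (simp add: ennreal_mult_less_top)
    then have "Lp_norm p \<mu> f < \<infinity>" by (rule le_less_trans[OF bound[OF f(1)]])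
    moreover have "f \<in> borel_measurable \<mu>"
      by (intro continuous_on_upper_halfspace_measurable[OF assms(6)] harmonic_on_imp_continuous_on f(1))
    ultimately show ?thesis by (simp add: Lp_space_def)
  qed
  with B bound show "continuously_embedded (TL_space p \<tau> \<alpha>) (TL_norm p \<tau> \<alpha>) (Lp_space p \<mu>) (Lp_norm p \<mu>)"
    unfolding continuously_embedded_def by (auto simp: TL_space_def)
next
  assume "continuously_embedded (TL_space p \<tau> \<alpha>) (TL_norm p \<tau> \<alpha>) (Lp_space p \<mu>) (Lp_norm p \<mu>)"
  then obtain C :: real where C: "0 \<le> C"
    "\<And>f. f \<in> TL_space p \<tau> \<alpha> \<Longrightarrow> Lp_norm p \<mu> f \<le> ennreal C * TL_norm p \<tau> \<alpha> f"
    unfolding continuously_embedded_def by blast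
  have p: "0 < p" using assms(2,3) by simp
  obtain M where "0 \<le> M" "\<And>k. k \<ge> 1 \<Longrightarrow> emeasure \<mu> (cube (\<xi> k, \<eta> k) (s k))
      \<le> ennreal (M * \<eta> k powr (real CARD('n) + \<alpha> * p))"
    by (rule carleson_if_embedded[OF assms(1,2) p assms(4-6) C]) (assumption, rule that)
  then show "\<exists>C::real. C \<ge> 0 \<and> (\<forall>k\<ge>1. emeasure \<mu> (cube (\<xi> k, \<eta> k) (s k))
            \<le> ennreal (C * \<eta> k powr (real CARD('n) + \<alpha> * p)))" by blast
qed

end
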